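(* Let $B=(I-\varepsilon^2M_t^{-1}M_a)P_0$ and consider the linear system $\left[(I+\varepsilon H)-B\right]\boldsymbol\psi=\mathbf s$ with splitting $H=H_{\le}+H_{>}$. Let $I-T_\varepsilon=(I+\varepsilon H)^{-1}\left[(I+\varepsilon H)-B\right]$ be the preconditioned matrix that corresponds to applying $(I+\varepsilon H)^{-1}$ as a preconditioner. Let $I-\widetilde T_\varepsilon$ be the preconditioned matrix associated with applying three iterations of $(I+\varepsilon H_{\le})^{-1}$ to the system while keeping the term $B\boldsymbol\psi$ fixed; that is, $I-\widetilde T_\varepsilon=\widehat M_3^{-1}\left[(I+\varepsilon H)-B\right]$, where $\widehat M_3^{-1}$ is determined by $I-\widehat M_3^{-1}(I+\varepsilon H)=\left(I-(I+\varepsilon H_{\le})^{-1}(I+\varepsilon H)\right)^3$. Then, as $\varepsilon\to0$, $$\widetilde T_\varepsilon=T_\varepsilon+\mathcal O(\varepsilon^3).$$ Moreover, let $E_\varepsilon$ be the operator acting blockwise in the direction index $d$ by either of the DSA preconditioners $$\text{(i)}\ \left(\varepsilon^2D_\varepsilon\right)^{-1}M_t\qquad\text{or}\qquad\text{(ii)}\ \frac1\varepsilon\left[\frac1\varepsilon E_P+(I-E_PD_0)E_Q(I-D_0E_P)\right]M_t .$$ Then $$E_\varepsilon P_0\left(I-T_\varepsilon\right)P_0=E_\varepsilon P_0\left(I-\widetilde T_\varepsilon\right)P_0+\mathcal O(\varepsilon).$$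
   Context: Setting. Let $\mathcal{D}\subset\mathbb{R}^n$, $n\le 3$, be a spatial domain decomposed into a finite set $\mathcal{E}$ of (possibly curved) elements $\kappa$, each the image of a reference element $\hat\kappa$, and let $\mathcal{F}$ be the set of interior and boundary element faces. $\mathcal{U}$ is the discontinuous Galerkin space of functions in $L^2(\mathcal{D})$ whose pullback to the reference element is, on each element, a polynomial of fixed degree $r$; $N=\dim\mathcal{U}$, a basis of $\mathcal{U}$ is fixed, and $\mathbf{u},\mathbf{v}\in\mathbb{R}^N$ denote the coefficient vectors of $u,v\in\mathcal{U}$. Each face has a fixed (arbitrary sign) unit normal $\mathbf{n}$; on an interior face shared by $\kappa,\kappa'$ with $\mathbf{n}$ pointing from $\kappa$ to $\kappa'$, $\llbracket u\rrbracket=u_\kappa-u_{\kappa'}$ and $\{u\}=(u_\kappa+u_{\kappa'})/2$; on a boundary face of $\kappa$ ($\mathbf n$ outward), $\llbracket u\rrbracket=u_\kappa$ and $\{u\}=u_\kappa$. Angular quadrature: directions $\boldsymbol{\Omega}_d\in\mathbb{S}^2$ and weights $w_d>0$, $d=1,\dots,N_\Omega$ (if $n<3$ only the first $n$ components of $\boldsymbol\Omega_d$ are used in spatial expressions). Each $\boldsymbol{\Omega}_d$ has a reversed direction $\boldsymbol\Omega_{d'}=-\boldsymbol\Omega_d$ with $w_{d'}=w_d$, and $\sum_d w_d=4\pi$, $\sum_d w_d\boldsymbol\Omega_d\boldsymbol\Omega_d^T=\frac{4\pi}{3}I$, $\sum_d w_d\boldsymbol\Omega_d=\mathbf 0$,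 $\sum_d w_d\boldsymbol\Omega_d|\boldsymbol\Omega_d\cdot\mathbf n|=\mathbf 0$. Matrices ($\sigma_t>0$ total opacity, $\sigma_a$ absorption opacity, both given functions independent of $\varepsilon$): $\mathbf{G}=(G_1,\dots,G_n)$ is a vector of $N\times N$ matrices, $\boldsymbol\Omega_d\cdot\mathbf G=\sum_j(\boldsymbol\Omega_d)_jG_j$, and $$\mathbf v^T(\boldsymbol\Omega_d\cdot\mathbf G)\mathbf u=\sum_{\kappa\in\mathcal E}\int_\kappa(\boldsymbol\Omega_d\cdot\nabla u)v\,d\mathbf x,\quad \mathbf v^TM_t\mathbf u=\sum_\kappa\int_\kappa\sigma_tuv\,d\mathbf x,\quad \mathbf v^TM_a\mathbf u=\sum_\kappa\int_\kappa\sigma_auv\,d\mathbf x,$$ $$\mathbf v^TF^{(d)}\mathbf u=-\sum_{\Gamma\in\mathcal F}\int_\Gamma\boldsymbol\Omega_d\cdot\mathbf n\,\llbracket u\rrbracket\{v\}\,dS+\frac12\sum_{\Gamma\in\mathcal F}\int_\Gamma|\boldsymbol\Omega_d\cdot\mathbf n|\,\llbracket u\rrbracket\llbracket v\rrbracket\,dS,$$ $$\mathbf v^T\tilde F^{(d)}\mathbf u=\sum_{\Gamma\in\mathcal F}\int_\Gamma\boldsymbol\Omega_d\cdot\mathbf n\,\{u\}\llbracket v\rrbracket\,dS+\frac12\sum_{\Gamma\in\mathcal F}\int_\Gamma|\boldsymbol\Omega_d\cdot\mathbf n|\,\llbracket u\rrbracket\llbracket v\rrbracket\,dS.$$ Global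 vectors are $\boldsymbol\psi=(\boldsymbol\psi^{(1)};\dots;\boldsymbol\psi^{(N_\Omega)})\in\mathbb R^{NN_\Omega}$; $N\times N$ matrices such as $M_t^{-1}M_a$ act on them blockwise. $P_0$ is the projection $(P_0\boldsymbol\psi)^{(d)}=\frac1{4\pi}\sum_{d'}w_{d'}\boldsymbol\psi^{(d')}$ for every $d$. $H=\mathrm{diag}_d\left[M_t^{-1}(\boldsymbol\Omega_d\cdot\mathbf G+F^{(d)})\right]$. A mesh element ordering is chosen, giving a decomposition $F^{(d)}=F^{(d)}_{\le}+F^{(d)}_{>}$ (with $F^{(d)}_{\le}$ the element-block lower-triangular part, including the diagonal blocks, in this ordering), and $H_{\le}=\mathrm{diag}_d\left[M_t^{-1}(\boldsymbol\Omega_d\cdot\mathbf G+F^{(d)}_{\le})\right]$, $H_{>}=\mathrm{diag}_d\left[M_t^{-1}F^{(d)}_{>}\right]$, so $H=H_{\le}+H_{>}$. The three iterations are $\boldsymbol\psi_{k+1}=\boldsymbol\psi_k+(I+\varepsilon H_{\le})^{-1}\left(\mathbf s+B\boldsymbol\psi_0-(I+\varepsilon H)\boldsymbol\psi_k\right)$, $k=0,1,2$, with $B\boldsymbol\psi_0$ held fixed; equivalently $\boldsymbol\psi_3=\boldsymbol\psi_0+\widehat M_3^{-1}(\mathbf s-[(I+\varepsilon H)-B]\boldsymbol\psi_0)$. DSA ingredients: $F_0=\frac1{4\pi}\sum_dw_dF^{(d)}$, $\mathbf F_1=\frac1{4\pi}\sum_dw_d\boldsymbol\Omega_dF^{(d)}$,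 $\tilde{\mathbf F}_1=\frac1{4\pi}\sum_dw_d\boldsymbol\Omega_d\tilde F^{(d)}$ (vectors of matrices), $$D_0=\tfrac13\mathbf G^T\cdot M_t^{-1}\mathbf G-\tilde{\mathbf F}_1\cdot M_t^{-1}\mathbf G+\mathbf G^T\cdot M_t^{-1}\mathbf F_1+M_a,\qquad D_\varepsilon=\tfrac1\varepsilon F_0+D_0,$$ where dot products are over the component index. $P$ is a projection of $\mathbb R^N$ onto the coefficient vectors of continuous functions in $\mathcal U$ with zero boundary values, $Q=I-P$, $E_P=P(P^TD_0P)^{-1}P^T$, $E_Q=Q(Q^TF_0Q)^{-1}Q^T$, where $(P^TD_0P)^{-1}$ is the inverse of $P^TD_0P$ from the range of $P$ to the range of $P^T$, and $(Q^TF_0Q)^{-1}$ the inverse of $Q^TF_0Q$ from the range of $Q$ to the range of $Q^T$. $P^TD_0P$ is assumed invertible as a map from the range of $P$ to the range of $P^T$. In case (i) it is assumed that $\alpha(\mathbf x)=\frac1{4\pi}\sum_dw_d|\boldsymbol\Omega_d\cdot\mathbf n(\mathbf x)|$ is uniformly bounded away from zero on each interior and boundary face; in case (ii) it is assumed that $Q^TF_0Q$ is invertible as a map from the range of $Q$ to the range of $Q^T$. Standing assumptions: $\varepsilon\|M_t^{-1}(\boldsymbol\Omega_d\cdot\mathbf G+F^{(d)})\|<1$ and $\varepsilon^2\|M_t^{-1}M_a\|<1$. The mesh, $\mathcal U$, opacities, quadrature and splitting are fixed, and $\mathcal O(\varepsilon^k)$ denotes a matrix whose norm is at most $C\varepsilon^k$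 for all sufficiently small $\varepsilon>0$. *)

theory Defs
  imports "HOL-Analysis.Analysis" "HOL-Library.Landau_Symbols"
begin

section \<open>Data of the discretization\<close>

text \<open>
  A face is stored through one of its elements: \<open>owner\<close> is the element \<open>\<kappa>\<close> out of which
  the fixed normal points, \<open>nbr\<close> is \<open>Some \<kappa>'\<close> on an interior face and \<open>None\<close> on a
  boundary face, and \<open>patch\<close> is the preimage of the face in the reference element of
  the owner. The patch may be a proper part of a facet, so that meshes with hanging nodes
  are included. The sign of the normal is arbitrary because either element
  may be taken as the owner.
\<close>

record ('e, 'n) face =
  owner :: 'e
  nbr :: "'e option"
  patch :: "(real^'n) set"

text \<open>
  \<open>'n\<close>: spatial coordinates; \<open>'e\<close>: names of elements; \<open>'k\<close>: basis of the discontinuous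
  Galerkin space, so that its dimension is \<open>CARD('k)\<close>; \<open>'d\<close>: discrete directions.
  \<open>coord\<close> says which of the three components of a direction belongs to a spatial coordinate;
  \<open>rank\<close> is the chosen ordering of the elements.
\<close>

record ('e, 'n, 'k, 'd) dg_setup =
  region :: "(real^'n) set"
  elems :: "'e set"
  refel :: "'e \<Rightarrow> (real^'n) set"
  emap :: "'e \<Rightarrow> real^'n \<Rightarrow> real^'n"
  faces :: "('e, 'n) face set"
  rank :: "'e \<Rightarrow> nat"
  degr :: nat
  basis :: "'k \<Rightarrow> real^'n \<Rightarrow> real"
  coord :: "'n \<Rightarrow> 3"
  dir :: "'d \<Rightarrow> real^3"
  wt :: "'d \<Rightarrow> real"
  sigma_t :: "real^'n \<Rightarrow> real"
  sigma_a :: "real^'n \<Rightarrow> real"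


section \<open>Mesh\<close>

definition jac :: "(real^'n \<Rightarrow> real^'n) \<Rightarrow> real^'n \<Rightarrow> real^'n^'n" where
  "jac \<phi> y = matrix (frechet_derivative \<phi> (at y))"

definition C1_embedding_near :: "(real^'n) set \<Rightarrow> (real^'n \<Rightarrow> real^'n) \<Rightarrow> bool" where
  "C1_embedding_near K \<phi> \<longleftrightarrow>
     (\<exists>V. open V \<and> K \<subseteq> V \<and> inj_on \<phi> V \<and> \<phi> differentiable_on V \<and>
          continuous_on V (jac \<phi>) \<and> (\<forall>y\<in>V. det (jac \<phi> y) \<noteq> 0))"

definition elem :: "('e, 'n::finite, 'k, 'd) dg_setup \<Rightarrow> 'e \<Rightarrow> (real^'n) set" where
  "elem S \<kappa> = emap S \<kappa> ` refel S \<kappa>"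

definition open_elem :: "('e, 'n::finite, 'k, 'd) dg_setup \<Rightarrow> 'e \<Rightarrow> (real^'n) set" where
  "open_elem S \<kappa> = emap S \<kappa> ` interior (refel S \<kappa>)"

definition face_set :: "('e, 'n::finite, 'k, 'd) dg_setup \<Rightarrow> ('e, 'n::finite) face \<Rightarrow> (real^'n) set" where
  "face_set S f = emap S (owner f) ` patch f"

definition valid_face :: "('e, 'n::finite, 'k, 'd) dg_setup \<Rightarrow> ('e, 'n::finite) face \<Rightarrow> bool" where
  "valid_face S f \<longleftrightarrow>
     owner f \<in> elems S \<and>
     polytope (patch f) \<and> aff_dim (patch f) = int CARD('n) - 1 \<and>
     (\<exists>G. G facet_of refel S (owner f) \<and> patch f \<subseteq> G) \<and>
     (case nbr f of
        None \<Rightarrow> face_set S f \<subseteq> frontier (region S)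
      | Some \<kappa>' \<Rightarrow> \<kappa>' \<in> elems S \<and> \<kappa>' \<noteq> owner f \<and> face_set S f \<subseteq> elem S \<kappa>')"

definition valid_mesh :: "('e, 'n::finite, 'k, 'd) dg_setup \<Rightarrow> bool" where
  "valid_mesh S \<longleftrightarrow>
     CARD('n) \<le> 3 \<and>
     open (region S) \<and> finite (elems S) \<and> elems S \<noteq> {} \<and>
     (\<forall>\<kappa>\<in>elems S. polytope (refel S \<kappa>) \<and> interior (refel S \<kappa>) \<noteq> {} \<and>
        C1_embedding_near (refel S \<kappa>) (emap S \<kappa>)) \<and>
     closure (region S) = (\<Union>\<kappa>\<in>elems S. elem S \<kappa>) \<and>
     disjoint_family_on (open_elem S) (elems S) \<and>
     finite (faces S) \<and> (\<forall>f\<in>faces S. valid_face S f) \<and>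
     disjoint_family_on (\<lambda>f. emap S (owner f) ` rel_interior (patch f)) (faces S) \<and>
     (\<forall>\<kappa>\<in>elems S. emap S \<kappa> ` frontier (refel S \<kappa>) =
        \<Union> (face_set S ` {f\<in>faces S. owner f = \<kappa> \<or> nbr f = Some \<kappa>})) \<and>
     frontier (region S) = \<Union> (face_set S ` {f\<in>faces S. nbr f = None}) \<and>
     inj_on (rank S) (elems S)"


section \<open>Discontinuous Galerkin space\<close>

definition poly_fun :: "nat \<Rightarrow> (real^'n \<Rightarrow> real) \<Rightarrow> bool" where
  "poly_fun r p \<longleftrightarrow>
     (\<exists>c. \<forall>y. p y = (\<Sum>a | sum a (UNIV::'n set) \<le> r. c a * (\<Prod>i\<in>UNIV. (y $ i) ^ a i)))"

text \<open>
  Elements of \<open>L\<^sup>2\<close> are represented by functions that are polynomial (in reference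
  coordinates) everywhere in the open elements; their values on the mesh skeleton, a null
  set, are irrelevant. Equality in \<open>L\<^sup>2\<close> is equality almost everywhere.
\<close>

definition dg_space :: "('e, 'n::finite, 'k, 'd) dg_setup \<Rightarrow> (real^'n \<Rightarrow> real) set" where
  "dg_space S = {u.
     u \<in> borel_measurable (lebesgue_on (region S)) \<and>
     integrable (lebesgue_on (region S)) (\<lambda>x. (u x)\<^sup>2) \<and>
     (\<forall>\<kappa>\<in>elems S. \<exists>p. poly_fun (degr S) p \<and>
        (\<forall>y\<in>interior (refel S \<kappa>). u (emap S \<kappa> y) = p y))}"

definition fun_of :: "('e, 'n::finite, 'k::finite, 'd) dg_setup \<Rightarrow> real^'k \<Rightarrow> real^'n \<Rightarrow> real" where
  "fun_of S c = (\<lambda>x. \<Sum>i\<in>UNIV. c $ i * basis S i x)"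

definition valid_basis :: "('e, 'n::finite, 'k::finite, 'd) dg_setup \<Rightarrow> bool" where
  "valid_basis S \<longleftrightarrow>
     (\<forall>i. basis S i \<in> dg_space S) \<and>
     (\<forall>u\<in>dg_space S. \<exists>!c. AE x in lebesgue_on (region S). u x = fun_of S c x)"

definition continuous_coeffs :: "('e, 'n::finite, 'k::finite, 'd) dg_setup \<Rightarrow> (real^'k) set" where
  "continuous_coeffs S = {c. \<exists>g. continuous_on (closure (region S)) g \<and>
     (\<forall>x\<in>frontier (region S). g x = 0) \<and>
     (AE x in lebesgue_on (region S). fun_of S c x = g x)}"

text \<open>The one-sided value \<open>u\<^sub>\<kappa>\<close> on the boundary of \<open>\<kappa>\<close>.\<close>

definition trace_on :: "('e, 'n::finite, 'k, 'd) dg_setup \<Rightarrow> 'e \<Rightarrow> (real^'n \<Rightarrow> real) \<Rightarrow> real^'n \<Rightarrow> real" where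
  "trace_on S \<kappa> u x = Lim (at x within open_elem S \<kappa>) u"

definition jump :: "('e, 'n::finite, 'k, 'd) dg_setup \<Rightarrow> ('e, 'n::finite) face \<Rightarrow> (real^'n \<Rightarrow> real) \<Rightarrow> real^'n \<Rightarrow> real" where
  "jump S f u x = (case nbr f of
      None \<Rightarrow> trace_on S (owner f) u x
    | Some \<kappa>' \<Rightarrow> trace_on S (owner f) u x - trace_on S \<kappa>' u x)"

definition avg :: "('e, 'n::finite, 'k, 'd) dg_setup \<Rightarrow> ('e, 'n::finite) face \<Rightarrow> (real^'n \<Rightarrow> real) \<Rightarrow> real^'n \<Rightarrow> real" where
  "avg S f u x = (case nbr f of
      None \<Rightarrow> trace_on S (owner f) u x
    | Some \<kappa>' \<Rightarrow> (trace_on S (owner f) u x + trace_on S \<kappa>' u x) / 2)"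


section \<open>Integrals over faces\<close>

text \<open>The outward unit normal of the convex body \<open>K\<close> along a subset \<open>p\<close> of one of its facets;
  it is unique if \<open>K\<close> has nonempty interior and \<open>p\<close> has codimension one.\<close>

definition flat_normal :: "(real^'n) set \<Rightarrow> (real^'n) set \<Rightarrow> real^'n" where
  "flat_normal K p = (SOME \<nu>. norm \<nu> = 1 \<and> (\<forall>y\<in>p. \<forall>z\<in>K. \<nu> \<bullet> z \<le> \<nu> \<bullet> y))"

text \<open>
  Integral of \<open>h\<close> over a subset \<open>p\<close> of a hyperplane with unit normal \<open>\<nu>\<close>, with respect to
  surface measure of codimension one: by Fubini it is the volume integral over the
  prism of height one erected on \<open>p\<close> of the function that equals \<open>h\<close> at the foot point.
\<close>

definition flat_integral :: "(real^'n) set \<Rightarrow> real^'n \<Rightarrow> (real^'n \<Rightarrow> real) \<Rightarrow> real" where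
  "flat_integral p \<nu> h =
     (let c = \<nu> \<bullet> (SOME y. y \<in> p) in
      LINT x : {y + t *\<^sub>R \<nu> | y t. y \<in> p \<and> 0 \<le> t \<and> t \<le> 1} | lebesgue.
        h (x - (\<nu> \<bullet> x - c) *\<^sub>R \<nu>))"

text \<open>
  Nanson's formula: under \<open>x = \<phi> y\<close> with Jacobian \<open>J\<close>, the outward normal is the direction
  of \<open>J\<^sup>-\<^sup>T \<nu>\<close> and the surface elements satisfy \<open>dS = \<bar>det J\<bar> \<parallel>J\<^sup>-\<^sup>T \<nu>\<parallel> dS'\<close>. The normal and the
  surface element at a point of the face are given as functions of the reference point.
\<close>

definition conormal :: "('e, 'n::finite, 'k, 'd) dg_setup \<Rightarrow> ('e, 'n::finite) face \<Rightarrow> real^'n \<Rightarrow> real^'n" where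
  "conormal S f y = transpose (matrix_inv (jac (emap S (owner f)) y)) *v
     flat_normal (refel S (owner f)) (patch f)"

definition face_normal :: "('e, 'n::finite, 'k, 'd) dg_setup \<Rightarrow> ('e, 'n::finite) face \<Rightarrow> real^'n \<Rightarrow> real^'n" where
  "face_normal S f y = conormal S f y /\<^sub>R norm (conormal S f y)"

text \<open>\<open>h\<close> takes the point of the face and the unit normal there.\<close>

definition face_integral ::
  "('e, 'n::finite, 'k, 'd) dg_setup \<Rightarrow> ('e, 'n::finite) face \<Rightarrow> (real^'n \<Rightarrow> real^'n \<Rightarrow> real) \<Rightarrow> real" where
  "face_integral S f h =
     flat_integral (patch f) (flat_normal (refel S (owner f)) (patch f))
       (\<lambda>y. h (emap S (owner f) y) (face_normal S f y) *
            (\<bar>det (jac (emap S (owner f)) y)\<bar> * norm (conormal S f y)))"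


section \<open>Angular quadrature and opacities\<close>

definition sdir :: "('e, 'n::finite, 'k, 'd) dg_setup \<Rightarrow> 'd \<Rightarrow> real^'n" where
  "sdir S d = (\<chi> m. dir S d $ coord S m)"

definition valid_quadrature :: "('e, 'n::finite, 'k, 'd::finite) dg_setup \<Rightarrow> bool" where
  "valid_quadrature S \<longleftrightarrow>
     bij_betw (coord S) UNIV (of_nat ` {1..CARD('n)}) \<and>
     (\<forall>d. norm (dir S d) = 1 \<and> wt S d > 0) \<and>
     (\<forall>d. \<exists>d'. dir S d' = - dir S d \<and> wt S d' = wt S d) \<and>
     (\<Sum>d\<in>UNIV. wt S d) = 4 * pi \<and>
     (\<Sum>d\<in>UNIV. wt S d *\<^sub>R (\<chi> i j. dir S d $ i * dir S d $ j)) = (4 * pi / 3) *\<^sub>R (mat 1 :: real^3^3) \<and>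
     (\<Sum>d\<in>UNIV. wt S d *\<^sub>R dir S d) = 0 \<and>
     (\<forall>\<nu>. norm \<nu> = 1 \<longrightarrow> (\<Sum>d\<in>UNIV. (wt S d * \<bar>sdir S d \<bullet> \<nu>\<bar>) *\<^sub>R dir S d) = 0)"

text \<open>Integrability makes the mass matrices meaningful.\<close>

definition valid_opacities :: "('e, 'n::finite, 'k, 'd) dg_setup \<Rightarrow> bool" where
  "valid_opacities S \<longleftrightarrow>
     (\<forall>x\<in>region S. sigma_t S x > 0) \<and>
     integrable (lebesgue_on (region S)) (sigma_t S) \<and>
     integrable (lebesgue_on (region S)) (sigma_a S)"

definition valid_setup :: "('e, 'n::finite, 'k::finite, 'd::finite) dg_setup \<Rightarrow> bool" where
  "valid_setup S \<longleftrightarrow> valid_mesh S \<and> valid_basis S \<and> valid_quadrature S \<and> valid_opacities S"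


section \<open>Discretization matrices\<close>

text \<open>The matrix \<open>A\<close> with \<open>v\<^sup>T A u = a u v\<close> for a form \<open>a\<close> that is bilinear on the space.\<close>

definition form_matrix ::
  "('e, 'n::finite, 'k::finite, 'd) dg_setup \<Rightarrow> ((real^'n \<Rightarrow> real) \<Rightarrow> (real^'n \<Rightarrow> real) \<Rightarrow> real) \<Rightarrow> real^'k^'k" where
  "form_matrix S a = (\<chi> i j. a (basis S j) (basis S i))"

lemma form_matrix_inner:
  assumes "\<And>c v. a (fun_of S c) v = (\<Sum>j\<in>UNIV. c $ j * a (basis S j) v)"
    and "\<And>u c. a u (fun_of S c) = (\<Sum>i\<in>UNIV. c $ i * a u (basis S i))"
  shows "v \<bullet> (form_matrix S a *v u) = a (fun_of S u) (fun_of S v)"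
proof -
  have "v \<bullet> (form_matrix S a *v u) =
      (\<Sum>i\<in>UNIV. v $ i * (\<Sum>j\<in>UNIV. a (basis S j) (basis S i) * u $ j))"
    by (simp add: form_matrix_def inner_vec_def matrix_vector_mult_def)
  also have "\<dots> = a (fun_of S u) (fun_of S v)"
    by (simp add: assms mult.commute)
  finally show ?thesis .
qed

definition Gmat :: "('e, 'n::finite, 'k::finite, 'd) dg_setup \<Rightarrow> 'n \<Rightarrow> real^'k^'k" where
  "Gmat S m = form_matrix S (\<lambda>u v. \<Sum>\<kappa>\<in>elems S.
     LINT x:elem S \<kappa>|lebesgue. frechet_derivative u (at x) (axis m 1) * v x)"

definition dirG :: "('e, 'n::finite, 'k::finite, 'd) dg_setup \<Rightarrow> 'd \<Rightarrow> real^'k^'k" where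
  "dirG S d = (\<Sum>m\<in>UNIV. (sdir S d $ m) *\<^sub>R Gmat S m)"

definition Mt :: "('e, 'n::finite, 'k::finite, 'd) dg_setup \<Rightarrow> real^'k^'k" where
  "Mt S = form_matrix S (\<lambda>u v. \<Sum>\<kappa>\<in>elems S. LINT x:elem S \<kappa>|lebesgue. sigma_t S x * u x * v x)"

definition Ma :: "('e, 'n::finite, 'k::finite, 'd) dg_setup \<Rightarrow> real^'k^'k" where
  "Ma S = form_matrix S (\<lambda>u v. \<Sum>\<kappa>\<in>elems S. LINT x:elem S \<kappa>|lebesgue. sigma_a S x * u x * v x)"

definition Fform ::
  "('e, 'n::finite, 'k, 'd) dg_setup \<Rightarrow> 'd \<Rightarrow> (real^'n \<Rightarrow> real) \<Rightarrow> (real^'n \<Rightarrow> real) \<Rightarrow> real" where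
  "Fform S d u v =
     - (\<Sum>f\<in>faces S. face_integral S f (\<lambda>x n. (sdir S d \<bullet> n) * jump S f u x * avg S f v x))
     + 1/2 * (\<Sum>f\<in>faces S. face_integral S f (\<lambda>x n. \<bar>sdir S d \<bullet> n\<bar> * jump S f u x * jump S f v x))"

definition Fmat :: "('e, 'n::finite, 'k::finite, 'd) dg_setup \<Rightarrow> 'd \<Rightarrow> real^'k^'k" where
  "Fmat S d = form_matrix S (Fform S d)"

definition Ftilde :: "('e, 'n::finite, 'k::finite, 'd) dg_setup \<Rightarrow> 'd \<Rightarrow> real^'k^'k" where
  "Ftilde S d = form_matrix S (\<lambda>u v.
     (\<Sum>f\<in>faces S. face_integral S f (\<lambda>x n. (sdir S d \<bullet> n) * avg S f u x * jump S f v x))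
     + 1/2 * (\<Sum>f\<in>faces S. face_integral S f (\<lambda>x n. \<bar>sdir S d \<bullet> n\<bar> * jump S f u x * jump S f v x)))"

text \<open>
  Element blocks: a function of the discontinuous Galerkin space is the sum of its
  restrictions to the elements, and the block \<open>(\<kappa>, \<kappa>')\<close> of \<open>F\<close> couples the part of \<open>u\<close>
  on \<open>\<kappa>'\<close> with the part of \<open>v\<close> on \<open>\<kappa>\<close>. If every basis function lives on one element,
  \<open>F_le\<close> is obtained from \<open>Fmat\<close> by keeping the entries of the blocks on and below
  the diagonal; the definition by restrictions makes sense for any basis.
\<close>

definition restr :: "('e, 'n::finite, 'k, 'd) dg_setup \<Rightarrow> 'e \<Rightarrow> (real^'n \<Rightarrow> real) \<Rightarrow> real^'n \<Rightarrow> real" where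
  "restr S \<kappa> u = (\<lambda>x. if x \<in> open_elem S \<kappa> then u x else 0)"

definition F_le :: "('e, 'n::finite, 'k::finite, 'd) dg_setup \<Rightarrow> 'd \<Rightarrow> real^'k^'k" where
  "F_le S d = form_matrix S (\<lambda>u v.
     \<Sum>\<kappa>\<in>elems S. \<Sum>\<kappa>'\<in>{\<kappa>'\<in>elems S. rank S \<kappa>' \<le> rank S \<kappa>}.
       Fform S d (restr S \<kappa>' u) (restr S \<kappa> v))"

definition F_gt :: "('e, 'n::finite, 'k::finite, 'd) dg_setup \<Rightarrow> 'd \<Rightarrow> real^'k^'k" where
  "F_gt S d = Fmat S d - F_le S d"


section \<open>Global operators\<close>

definition block_diag :: "('d::finite \<Rightarrow> real^'k::finite^'k) \<Rightarrow> real^('d \<times> 'k)^('d \<times> 'k)" where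
  "block_diag A = (\<chi> p q. if fst p = fst q then A (fst p) $ snd p $ snd q else 0)"

definition P0 :: "('e, 'n::finite, 'k::finite, 'd::finite) dg_setup \<Rightarrow> real^('d \<times> 'k)^('d \<times> 'k)" where
  "P0 S = (\<chi> p q. if snd p = snd q then wt S (fst q) / (4 * pi) else 0)"

definition Hmat :: "('e, 'n::finite, 'k::finite, 'd::finite) dg_setup \<Rightarrow> real^('d \<times> 'k)^('d \<times> 'k)" where
  "Hmat S = block_diag (\<lambda>d. matrix_inv (Mt S) ** (dirG S d + Fmat S d))"

definition H_le :: "('e, 'n::finite, 'k::finite, 'd::finite) dg_setup \<Rightarrow> real^('d \<times> 'k)^('d \<times> 'k)" where
  "H_le S = block_diag (\<lambda>d. matrix_inv (Mt S) ** (dirG S d + F_le S d))"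

definition H_gt :: "('e, 'n::finite, 'k::finite, 'd::finite) dg_setup \<Rightarrow> real^('d \<times> 'k)^('d \<times> 'k)" where
  "H_gt S = block_diag (\<lambda>d. matrix_inv (Mt S) ** F_gt S d)"

lemma Hmat_split: "Hmat S = H_le S + H_gt S"
proof -
  have "matrix_inv (Mt S) ** (dirG S d + Fmat S d) =
      matrix_inv (Mt S) ** (dirG S d + F_le S d) + matrix_inv (Mt S) ** F_gt S d" for d
    by (simp add: F_gt_def flip: matrix_add_ldistrib)
  then show ?thesis
    by (simp add: Hmat_def H_le_def H_gt_def block_diag_def vec_eq_iff)
qed

definition Bmat :: "('e, 'n::finite, 'k::finite, 'd::finite) dg_setup \<Rightarrow> real \<Rightarrow> real^('d \<times> 'k)^('d \<times> 'k)" where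
  "Bmat S \<epsilon> = (mat 1 - \<epsilon>\<^sup>2 *\<^sub>R block_diag (\<lambda>d. matrix_inv (Mt S) ** Ma S)) ** P0 S"

definition sweep :: "('e, 'n::finite, 'k::finite, 'd::finite) dg_setup \<Rightarrow> real \<Rightarrow> real^('d \<times> 'k)^('d \<times> 'k)" where
  "sweep S \<epsilon> = mat 1 + \<epsilon> *\<^sub>R Hmat S"

definition sweep_le :: "('e, 'n::finite, 'k::finite, 'd::finite) dg_setup \<Rightarrow> real \<Rightarrow> real^('d \<times> 'k)^('d \<times> 'k)" where
  "sweep_le S \<epsilon> = mat 1 + \<epsilon> *\<^sub>R H_le S"

text \<open>\<open>T_op\<close> and \<open>T_tilde\<close> are defined through the preconditioned matrices
  \<open>I - T_op\<close> and \<open>I - T_tilde\<close>.\<close>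

definition T_op :: "('e, 'n::finite, 'k::finite, 'd::finite) dg_setup \<Rightarrow> real \<Rightarrow> real^('d \<times> 'k)^('d \<times> 'k)" where
  "T_op S \<epsilon> = mat 1 - matrix_inv (sweep S \<epsilon>) ** (sweep S \<epsilon> - Bmat S \<epsilon>)"

definition M3_inv :: "('e, 'n::finite, 'k::finite, 'd::finite) dg_setup \<Rightarrow> real \<Rightarrow> real^('d \<times> 'k)^('d \<times> 'k)" where
  "M3_inv S \<epsilon> = (THE K. mat 1 - K ** sweep S \<epsilon> =
     (let X = mat 1 - matrix_inv (sweep_le S \<epsilon>) ** sweep S \<epsilon> in X ** X ** X))"

definition T_tilde :: "('e, 'n::finite, 'k::finite, 'd::finite) dg_setup \<Rightarrow> real \<Rightarrow> real^('d \<times> 'k)^('d \<times> 'k)" where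
  "T_tilde S \<epsilon> = mat 1 - M3_inv S \<epsilon> ** (sweep S \<epsilon> - Bmat S \<epsilon>)"


section \<open>Diffusion synthetic acceleration\<close>

definition F0 :: "('e, 'n::finite, 'k::finite, 'd::finite) dg_setup \<Rightarrow> real^'k^'k" where
  "F0 S = (1 / (4 * pi)) *\<^sub>R (\<Sum>d\<in>UNIV. wt S d *\<^sub>R Fmat S d)"

definition F1 :: "('e, 'n::finite, 'k::finite, 'd::finite) dg_setup \<Rightarrow> 'n \<Rightarrow> real^'k^'k" where
  "F1 S m = (1 / (4 * pi)) *\<^sub>R (\<Sum>d\<in>UNIV. (wt S d * sdir S d $ m) *\<^sub>R Fmat S d)"

definition F1_tilde :: "('e, 'n::finite, 'k::finite, 'd::finite) dg_setup \<Rightarrow> 'n \<Rightarrow> real^'k^'k" where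
  "F1_tilde S m = (1 / (4 * pi)) *\<^sub>R (\<Sum>d\<in>UNIV. (wt S d * sdir S d $ m) *\<^sub>R Ftilde S d)"

definition D0 :: "('e, 'n::finite, 'k::finite, 'd::finite) dg_setup \<Rightarrow> real^'k^'k" where
  "D0 S =
     (1/3) *\<^sub>R (\<Sum>m\<in>UNIV. transpose (Gmat S m) ** matrix_inv (Mt S) ** Gmat S m)
     - (\<Sum>m\<in>UNIV. F1_tilde S m ** matrix_inv (Mt S) ** Gmat S m)
     + (\<Sum>m\<in>UNIV. transpose (Gmat S m) ** matrix_inv (Mt S) ** F1 S m)
     + Ma S"

definition D_eps :: "('e, 'n::finite, 'k::finite, 'd::finite) dg_setup \<Rightarrow> real \<Rightarrow> real^'k^'k" where
  "D_eps S \<epsilon> = (1/\<epsilon>) *\<^sub>R F0 S + D0 S"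

definition compression_invertible :: "real^'k::finite^'k \<Rightarrow> real^'k^'k \<Rightarrow> bool" where
  "compression_invertible R A \<longleftrightarrow>
     bij_betw ((*v) (transpose R ** A ** R)) (range ((*v) R)) (range ((*v) (transpose R)))"

text \<open>\<open>R (R\<^sup>T A R)\<^sup>-\<^sup>1 R\<^sup>T\<close> with the inverse from the range of \<open>R\<^sup>T\<close> back to the range of \<open>R\<close>.\<close>

definition compression_solve :: "real^'k::finite^'k \<Rightarrow> real^'k^'k \<Rightarrow> real^'k^'k" where
  "compression_solve R A = matrix (\<lambda>x.
     R *v inv_into (range ((*v) R)) ((*v) (transpose R ** A ** R)) (transpose R *v x))"

definition continuous_projection :: "('e, 'n::finite, 'k::finite, 'd) dg_setup \<Rightarrow> real^'k^'k \<Rightarrow> bool" where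
  "continuous_projection S P \<longleftrightarrow> P ** P = P \<and> range ((*v) P) = continuous_coeffs S"

definition alpha_bounded_below :: "('e, 'n::finite, 'k, 'd::finite) dg_setup \<Rightarrow> bool" where
  "alpha_bounded_below S \<longleftrightarrow> (\<exists>a>0. \<forall>f\<in>faces S. \<forall>y\<in>patch f.
     a \<le> 1 / (4 * pi) * (\<Sum>d\<in>UNIV. wt S d * \<bar>sdir S d \<bullet> face_normal S f y\<bar>))"

definition DSA_full :: "('e, 'n::finite, 'k::finite, 'd::finite) dg_setup \<Rightarrow> real \<Rightarrow> real^('d \<times> 'k)^('d \<times> 'k)" where
  "DSA_full S \<epsilon> = block_diag (\<lambda>d. matrix_inv (\<epsilon>\<^sup>2 *\<^sub>R D_eps S \<epsilon>) ** Mt S)"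

definition DSA_two_step ::
  "('e, 'n::finite, 'k::finite, 'd::finite) dg_setup \<Rightarrow> real^'k^'k \<Rightarrow> real \<Rightarrow> real^('d \<times> 'k)^('d \<times> 'k)" where
  "DSA_two_step S P \<epsilon> =
     (let EP = compression_solve P (D0 S); EQ = compression_solve (mat 1 - P) (F0 S) in
      block_diag (\<lambda>d. ((1/\<epsilon>) *\<^sub>R
        ((1/\<epsilon>) *\<^sub>R EP + (mat 1 - EP ** D0 S) ** EQ ** (mat 1 - D0 S ** EP))) ** Mt S))"


section \<open>Asymptotics\<close>

definition opnorm :: "real^'m::finite^'m \<Rightarrow> real" where
  "opnorm A = onorm ((*v) A)"

definition standing :: "('e, 'n::finite, 'k::finite, 'd::finite) dg_setup \<Rightarrow> real \<Rightarrow> bool" where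
  "standing S \<epsilon> \<longleftrightarrow>
     (\<forall>d. \<epsilon> * opnorm (matrix_inv (Mt S) ** (dirG S d + Fmat S d)) < 1) \<and>
     \<epsilon>\<^sup>2 * opnorm (matrix_inv (Mt S) ** Ma S) < 1"

text \<open>\<open>\<epsilon> \<rightarrow> 0\<close> through positive values satisfying the standing assumptions. All sufficiently
  small positive \<open>\<epsilon>\<close> satisfy them, so this is the filter \<open>at_right 0\<close>.\<close>

definition eps_to_0 :: "('e, 'n::finite, 'k::finite, 'd::finite) dg_setup \<Rightarrow> real filter" where
  "eps_to_0 S = at 0 within {\<epsilon>. 0 < \<epsilon> \<and> standing S \<epsilon>}"

end

theory Submission
  imports Defs
begin

text \<open>
  With \<open>A = I + \<epsilon> H\<close> and \<open>X = I - (I + \<epsilon> H\<^sub>\<le>)\<^sup>-\<^sup>1 A = - \<epsilon> (I + \<epsilon> H\<^sub>\<le>)\<^sup>-\<^sup>1 H\<^sub>>\<close> the two preconditioned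
  matrices differ by \<open>X\<^sup>3 A\<^sup>-\<^sup>1 (A - B) = O(\<epsilon>\<^sup>3)\<close>, so it suffices that the DSA preconditioners are
  \<open>O(\<epsilon>\<^sup>-\<^sup>2)\<close>. This is immediate for (ii). For (i) it means that \<open>D\<^sub>\<epsilon>\<^sup>-\<^sup>1\<close> stays bounded although
  \<open>F\<^sub>0 / \<epsilon>\<close> is singular, which holds because \<open>F\<^sub>0\<close> is symmetric with kernel exactly the range of \<open>P\<close>.

  The quadratic form of \<open>F\<^sub>0\<close> is half the integral of \<open>\<alpha>\<close> times the squared jump over all faces, so
  the kernel consists of the functions without jumps. That such a function \<open>u\<close> is continuous across
  lower-dimensional parts of the mesh, where elements may touch without sharing a face, is seen
  by extending \<open>u\<close> by zero and following it along segments: the boundaries of the faces have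
  codimension two, so almost every segment avoids them and then meets at most one face at
  a time. Hence \<open>u\<close> is Lipschitz off these boundaries, and so extends continuously.
\<close>


section \<open>Matrices and operator norms\<close>

text \<open>The delicate point in (i) is that \<open>compression_invertible P (D0 S)\<close>
  controls \<open>D0 S\<close> on the range of \<open>P\<close> only. A vector outside that range
  but in the kernel of \<open>F0 S\<close> would be seen neither by \<open>F0 S\<close> / \<epsilon>
  nor by this hypothesis, and \<open>D_eps\<close> could degenerate along it. The kernel therefore
  has to be identified exactly, and a matrix estimate turns into a regularity statement about
  functions on the mesh. That continuous functions have no jumps is the easy inclusion. The converse
  is geometric, because \<open>valid_mesh\<close> describes the contact of elements through faces
  only and admits hanging nodes and curved elements, so nothing is known about how elements are
  arranged around a lower-dimensional part. Segments make this arrangement irrelevant: along a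
  segment that misses the exceptional set, the finitely many Lipschitz constants of the elements
  bound the total change, however often the segment switches elements. A Lipschitz bound, and not
  just continuity, is needed off the exceptional set, since a uniform bound is what allows an
  extension across it.\<close>

lemma matrix_inv:
  assumes "invertible A"
  shows matrix_inv_right: "A ** matrix_inv A = mat 1"
    and matrix_inv_left: "matrix_inv A ** A = mat 1"
  using someI_ex[OF assms[unfolded invertible_def]] by (simp_all add: matrix_inv_def)

lemma matrix_diff_distrib:
  fixes A B :: "real^'n^'m"
  shows matrix_sub_rdistrib: "(A - B) ** C = A ** C - B ** C"
    and matrix_sub_ldistrib: "D ** (A - B) = D ** A - D ** B"
  by (simp_all add: vec_eq_iff matrix_matrix_mult_def algebra_simps sum_subtractf)

lemma continuous_on_det:
  fixes A :: "'a::topological_space \<Rightarrow> real^'n^'n"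
  assumes "continuous_on T A"
  shows "continuous_on T (\<lambda>x. det (A x))"
  unfolding det_def
  by (intro continuous_intros assms)

text \<open>Cramer's rule writes each entry of the inverse as a quotient of determinants of matrices
  with continuous entries, and the denominator does not vanish.\<close>

lemma continuous_on_matrix_inv:
  fixes A :: "'a::topological_space \<Rightarrow> real^'n^'n"
  assumes A: "continuous_on T A" and det: "\<And>x. x \<in> T \<Longrightarrow> det (A x) \<noteq> 0"
  shows "continuous_on T (\<lambda>x. matrix_inv (A x))"
proof -
  have inv: "matrix_inv (A x) $ i $ j =
      det (\<chi> k l. if l = i then axis j 1 $ k else A x $ k $ l) / det (A x)"
    if "x \<in> T" for x i j
  proof -
    have "A x ** matrix_inv (A x) = mat 1"
      using det[OF that] by (simp add: invertible_det_nz matrix_inv_right)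
    then have "A x *v (matrix_inv (A x) *v axis j 1) = axis j 1"
      by (simp add: matrix_vector_mul_assoc)
    then have "matrix_inv (A x) *v axis j 1 =
        (\<chi> k. det (\<chi> i l. if l = k then axis j 1 $ i else A x $ i $ l) / det (A x))"
      using cramer[OF det[OF that]] by blast
    moreover have "matrix_inv (A x) $ i $ j = (matrix_inv (A x) *v axis j 1) $ i"
      by (simp add: matrix_vector_mult_basis column_def)
    ultimately show ?thesis by simp
  qed
  have "continuous_on T (\<lambda>x. \<chi> i j. det (\<chi> k l. if l = i then axis j 1 $ k else A x $ k $ l) / det (A x))"
  proof (intro continuous_on_vec_lambda continuous_on_divide continuous_on_det A ballI det)
    show "continuous_on T (\<lambda>x. if l = i then axis j 1 $ k else A x $ k $ l)" for i j k l
      by (cases "l = i") (auto intro!: continuous_intros A)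
  qed
  moreover have "matrix_inv (A x) =
      (\<chi> i j. det (\<chi> k l. if l = i then axis j 1 $ k else A x $ k $ l) / det (A x))" if "x \<in> T" for x
    by (simp add: vec_eq_iff inv that)
  ultimately show ?thesis by (simp cong: continuous_on_cong)
qed

lemma opnorm_bound: "norm (A *v x) \<le> opnorm A * norm x"
  unfolding opnorm_def by (rule onorm) simp

lemma opnorm_le: "(\<And>x. norm (A *v x) \<le> b * norm x) \<Longrightarrow> opnorm A \<le> b"
  unfolding opnorm_def by (rule onorm_le) simp

lemma opnorm_nonneg: "0 \<le> opnorm A"
  unfolding opnorm_def by (rule onorm_pos_le) simp

lemma opnorm_mult: "opnorm (A ** B) \<le> opnorm A * opnorm B"
proof (rule opnorm_le)
  fix x
  have "norm ((A ** B) *v x) \<le> opnorm A * norm (B *v x)"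
    using opnorm_bound[of A "B *v x"] by (simp add: matrix_vector_mul_assoc)
  also have "\<dots> \<le> opnorm A * (opnorm B * norm x)"
    by (intro mult_left_mono opnorm_bound opnorm_nonneg)
  finally show "norm ((A ** B) *v x) \<le> opnorm A * opnorm B * norm x" by (simp add: mult.assoc)
qed

lemma opnorm_add: "opnorm (A + B) \<le> opnorm A + opnorm B"
proof (rule opnorm_le)
  fix x
  show "norm ((A + B) *v x) \<le> (opnorm A + opnorm B) * norm x"
    using norm_triangle_ineq[of "A *v x" "B *v x"] opnorm_bound[of A x] opnorm_bound[of B x]
    by (simp add: matrix_vector_mult_add_rdistrib distrib_right)
qed

lemma opnorm_scaleR_le: "opnorm (r *\<^sub>R A) \<le> \<bar>r\<bar> * opnorm A"
proof (rule opnorm_le)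
  fix x
  have "norm ((r *\<^sub>R A) *v x) = \<bar>r\<bar> * norm (A *v x)"
    by (simp add: scaleR_matrix_vector_assoc[symmetric])
  also have "\<dots> \<le> \<bar>r\<bar> * (opnorm A * norm x)"
    by (intro mult_left_mono opnorm_bound) simp
  finally show "norm ((r *\<^sub>R A) *v x) \<le> \<bar>r\<bar> * opnorm A * norm x" by (simp add: mult.assoc)
qed

text \<open>A lower bound excludes a kernel, which for a square matrix already gives invertibility;
  applied to preimages it bounds the inverse. Both the solvability claims and the bounds on inverses
  for \<open>sweep\<close>, \<open>sweep_le\<close> and \<open>D_eps\<close> come from here.\<close>

lemma bounded_below_invertible:
  fixes A :: "real^'n^'n"
  assumes c: "0 < c" and below: "\<And>x. c * norm x \<le> norm (A *v x)"
  shows "invertible A" and "opnorm (matrix_inv A) \<le> 1 / c"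
proof -
  have "x = 0" if "A *v x = 0" for x
    using below[of x] c that by (simp add: mult_le_0_iff)
  then show inv: "invertible A"
    by (simp add: invertible_left_inverse matrix_left_invertible_ker)
  show "opnorm (matrix_inv A) \<le> 1 / c"
  proof (rule opnorm_le)
    fix x
    have "A *v (matrix_inv A *v x) = x"
      by (simp add: matrix_vector_mul_assoc matrix_inv_right[OF inv])
    then show "norm (matrix_inv A *v x) \<le> 1 / c * norm x"
      using below[of "matrix_inv A *v x"] c by (simp add: field_simps)
  qed
qed

section \<open>Orders of magnitude of matrix families as \<epsilon> tends to 0\<close>

text \<open>The exponent is an integer because the preconditioners have order -2 and are multiplied
  by an error of order 3. The sign condition on \<open>C\<close> allows bounds to be
  multiplied.\<close>

definition matrix_bigo :: "int \<Rightarrow> (real \<Rightarrow> real^'m^'m) \<Rightarrow> bool" where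
  "matrix_bigo k A \<longleftrightarrow> (\<exists>C\<ge>0. \<forall>\<^sub>F \<epsilon> in at_right 0. opnorm (A \<epsilon>) \<le> C * \<epsilon> powi k)"

lemma eventually_at_right_pos: "\<forall>\<^sub>F \<epsilon>::real in at_right 0. 0 < \<epsilon>"
  by (simp add: eventually_at_right_less)

lemma matrix_bigo_const: "matrix_bigo 0 (\<lambda>\<epsilon>. A)"
  unfolding matrix_bigo_def by (intro exI[of _ "opnorm A"]) (simp add: opnorm_nonneg)

lemma matrix_bigo_mult:
  assumes "matrix_bigo j A" "matrix_bigo k B"
  shows "matrix_bigo (j + k) (\<lambda>\<epsilon>. A \<epsilon> ** B \<epsilon>)"
proof -
  obtain C D where C: "C \<ge> 0" "\<forall>\<^sub>F \<epsilon> in at_right 0. opnorm (A \<epsilon>) \<le> C * \<epsilon> powi j"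
    and D: "D \<ge> 0" "\<forall>\<^sub>F \<epsilon> in at_right 0. opnorm (B \<epsilon>) \<le> D * \<epsilon> powi k"
    using assms by (auto simp: matrix_bigo_def)
  have "\<forall>\<^sub>F \<epsilon> in at_right 0. opnorm (A \<epsilon> ** B \<epsilon>) \<le> (C * D) * \<epsilon> powi (j + k)"
    using C(2) D(2) eventually_at_right_pos
  proof eventually_elim
    case (elim \<epsilon>)
    have "opnorm (A \<epsilon> ** B \<epsilon>) \<le> (C * \<epsilon> powi j) * (D * \<epsilon> powi k)"
      by (rule order_trans[OF opnorm_mult mult_mono])
        (use elim C(1) D(1) opnorm_nonneg in auto)
    then show ?case using elim(3) by (simp add: power_int_add mult_ac)
  qed
  then show ?thesis using C(1) D(1) unfolding matrix_bigo_def by (intro exI[of _ "C * D"]) simp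
qed

lemma matrix_bigo_add:
  assumes "matrix_bigo k A" "matrix_bigo k B"
  shows "matrix_bigo k (\<lambda>\<epsilon>. A \<epsilon> + B \<epsilon>)"
proof -
  obtain C D where C: "C \<ge> 0" "\<forall>\<^sub>F \<epsilon> in at_right 0. opnorm (A \<epsilon>) \<le> C * \<epsilon> powi k"
    and D: "D \<ge> 0" "\<forall>\<^sub>F \<epsilon> in at_right 0. opnorm (B \<epsilon>) \<le> D * \<epsilon> powi k"
    using assms by (auto simp: matrix_bigo_def)
  have "\<forall>\<^sub>F \<epsilon> in at_right 0. opnorm (A \<epsilon> + B \<epsilon>) \<le> (C + D) * \<epsilon> powi k"
    using C(2) D(2)
  proof eventually_elim
    case (elim \<epsilon>)
    then show ?case using opnorm_add[of "A \<epsilon>" "B \<epsilon>"] by (simp add: distrib_right)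
  qed
  then show ?thesis using C(1) D(1) unfolding matrix_bigo_def by (intro exI[of _ "C + D"]) simp
qed

lemma matrix_bigo_powi_scaleR:
  assumes "matrix_bigo k A"
  shows "matrix_bigo (j + k) (\<lambda>\<epsilon>. (\<epsilon> powi j) *\<^sub>R A \<epsilon>)"
proof -
  obtain C where C: "C \<ge> 0" "\<forall>\<^sub>F \<epsilon> in at_right 0. opnorm (A \<epsilon>) \<le> C * \<epsilon> powi k"
    using assms by (auto simp: matrix_bigo_def)
  have "\<forall>\<^sub>F \<epsilon> in at_right 0. opnorm ((\<epsilon> powi j) *\<^sub>R A \<epsilon>) \<le> C * \<epsilon> powi (j + k)"
    using C(2) eventually_at_right_pos
  proof eventually_elim
    case (elim \<epsilon>)
    have "opnorm ((\<epsilon> powi j) *\<^sub>R A \<epsilon>) \<le> \<epsilon> powi j * opnorm (A \<epsilon>)"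
      using opnorm_scaleR_le[of "\<epsilon> powi j" "A \<epsilon>"] elim(2) by simp
    also have "\<dots> \<le> \<epsilon> powi j * (C * \<epsilon> powi k)"
      using elim by (intro mult_left_mono) auto
    finally show ?case using elim(2) by (simp add: power_int_add mult_ac)
  qed
  then show ?thesis using C(1) unfolding matrix_bigo_def by blast
qed

lemma matrix_bigo_mono:
  assumes "matrix_bigo k A" "j \<le> k"
  shows "matrix_bigo j A"
proof -
  obtain C where C: "C \<ge> 0" "\<forall>\<^sub>F \<epsilon> in at_right 0. opnorm (A \<epsilon>) \<le> C * \<epsilon> powi k"
    using assms by (auto simp: matrix_bigo_def)
  have "\<forall>\<^sub>F \<epsilon>::real in at_right 0. \<epsilon> < 1"
    by (rule eventually_at_rightI[of 0 1]) auto
  with C(2) eventually_at_right_pos have "\<forall>\<^sub>F \<epsilon> in at_right 0. opnorm (A \<epsilon>) \<le> C * \<epsilon> powi j"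
  proof eventually_elim
    case (elim \<epsilon>)
    have "\<epsilon> powi k \<le> \<epsilon> powi j"
      using elim assms(2) by (intro power_int_decreasing) auto
    then show ?case using elim(1) C(1) by (meson mult_left_mono order_trans)
  qed
  then show ?thesis using C(1) unfolding matrix_bigo_def by blast
qed

lemma matrix_bigo_cong:
  assumes "matrix_bigo k A" "\<forall>\<^sub>F \<epsilon> in at_right 0. B \<epsilon> = A \<epsilon>"
  shows "matrix_bigo k B"
proof -
  obtain C where C: "C \<ge> 0" "\<forall>\<^sub>F \<epsilon> in at_right 0. opnorm (A \<epsilon>) \<le> C * \<epsilon> powi k"
    using assms by (auto simp: matrix_bigo_def)
  from C(2) assms(2) have "\<forall>\<^sub>F \<epsilon> in at_right 0. opnorm (B \<epsilon>) \<le> C * \<epsilon> powi k"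
    by eventually_elim simp
  then show ?thesis using C(1) unfolding matrix_bigo_def by blast
qed

lemma matrix_bigo_imp_bigo:
  assumes "matrix_bigo (int k) A"
  shows "(\<lambda>\<epsilon>. opnorm (A \<epsilon>)) \<in> O[at_right 0](\<lambda>\<epsilon>. \<epsilon> ^ k)"
proof -
  obtain C where C: "C \<ge> 0" "\<forall>\<^sub>F \<epsilon> in at_right 0. opnorm (A \<epsilon>) \<le> C * \<epsilon> powi int k"
    using assms by (auto simp: matrix_bigo_def)
  from C(2) eventually_at_right_pos
  have "\<forall>\<^sub>F \<epsilon> in at_right 0. norm (opnorm (A \<epsilon>)) \<le> C * norm (\<epsilon> ^ k)"
    by eventually_elim (simp add: opnorm_nonneg)
  then show ?thesis by (rule bigoI)
qed

lemma mat1_plus_small: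
  fixes H :: "real^'n^'n"
  shows "\<forall>\<^sub>F \<epsilon> in at_right 0. invertible (mat 1 + \<epsilon> *\<^sub>R H)"
    and "matrix_bigo 0 (\<lambda>\<epsilon>. matrix_inv (mat 1 + \<epsilon> *\<^sub>R H))"
proof -
  \<comment> \<open>The reverse triangle inequality gives the factor 1/2 as soon as \<epsilon> times
    the norm of \<open>H\<close> is at most 1/2. The summand 1 in the threshold below keeps it
    meaningful for \<open>H = 0\<close>.\<close>
  have *: "\<forall>\<^sub>F \<epsilon> in at_right 0. \<forall>x. (1/2) * norm x \<le> norm ((mat 1 + \<epsilon> *\<^sub>R H) *v x)"
  proof (rule eventually_at_rightI[of 0 "1 / (2 * (opnorm H + 1))"])
    fix \<epsilon> assume \<epsilon>: "\<epsilon> \<in> {0<..<1 / (2 * (opnorm H + 1))}"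
    have H: "0 < opnorm H + 1" using opnorm_nonneg[of H] by linarith
    with \<epsilon> have "\<epsilon> * (opnorm H + 1) < 1/2" by (simp add: field_simps)
    then have small: "\<epsilon> * opnorm H \<le> 1/2" using \<epsilon> by (simp add: distrib_left)
    show "\<forall>x. (1/2) * norm x \<le> norm ((mat 1 + \<epsilon> *\<^sub>R H) *v x)"
    proof
      fix x
      have "norm (\<epsilon> *\<^sub>R (H *v x)) \<le> \<epsilon> * (opnorm H * norm x)"
        using \<epsilon> opnorm_bound[of H x] by (simp add: mult_left_mono)
      also have "\<dots> \<le> 1/2 * norm x"
        using mult_right_mono[OF small, of "norm x"] by (simp add: mult.assoc)
      finally show "(1/2) * norm x \<le> norm ((mat 1 + \<epsilon> *\<^sub>R H) *v x)"
        using norm_diff_ineq[of x "\<epsilon> *\<^sub>R (H *v x)"]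
        by (simp add: matrix_vector_mult_add_rdistrib scaleR_matrix_vector_assoc[symmetric])
    qed
  qed (simp add: opnorm_nonneg add_nonneg_pos)
  show "\<forall>\<^sub>F \<epsilon> in at_right 0. invertible (mat 1 + \<epsilon> *\<^sub>R H)"
    using * by (rule eventually_mono) (rule bounded_below_invertible(1)[of "1/2"], auto)
  have "\<forall>\<^sub>F \<epsilon> in at_right 0. opnorm (matrix_inv (mat 1 + \<epsilon> *\<^sub>R H)) \<le> 1 / (1/2)"
    using * by (rule eventually_mono) (rule bounded_below_invertible(2), auto)
  then show "matrix_bigo 0 (\<lambda>\<epsilon>. matrix_inv (mat 1 + \<epsilon> *\<^sub>R H))"
    unfolding matrix_bigo_def by (intro exI[of _ 2]) simp
qed

section \<open>A singularly perturbed linear system\<close>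

lemma subspace_range_matrix: "subspace (range ((*v) (P :: real^'n^'m)))"
  by (intro linear_subspace_image subspace_UNIV) simp

lemma matrix_bounded_below_on:
  fixes A :: "real^'n^'m"
  assumes "subspace U" "\<And>x. x \<in> U \<Longrightarrow> A *v x = 0 \<Longrightarrow> x = 0"
  obtains c where "0 < c" "\<And>x. x \<in> U \<Longrightarrow> c * norm x \<le> norm (A *v x)"
  using injective_imp_isometric[OF closed_subspace[OF assms(1)] assms(1), of "(*v) A"] assms(2) by auto

text \<open>In the splitting \<open>x = p + q\<close> into the kernel of \<open>F\<close> and its complement, the singular term
  forces \<open>q = O(\<epsilon>)\<close>, and \<open>D\<close> controls \<open>p\<close> because \<open>P\<^sup>T F = (F P)\<^sup>T = 0\<close>.\<close>

lemma singular_perturbation_bounded_below: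
  fixes P F D :: "real^'k^'k"
  assumes proj: "P ** P = P" and sym: "transpose F = F"
    and ker: "range ((*v) P) = {x. F *v x = 0}"
    and inv: "compression_invertible P D"
  shows "\<exists>c>0. \<forall>\<^sub>F \<epsilon> in at_right 0. \<forall>x. c * norm x \<le> norm (((1/\<epsilon>) *\<^sub>R F + D) *v x)"
proof -
  let ?PT = "transpose P"
  have Pp: "P *v p = p" if "p \<in> range ((*v) P)" for p
    using that proj by (auto simp: matrix_vector_mul_assoc)
  have FP: "F ** P = 0"
  proof -
    have "F *v (P *v x) = 0" for x using ker by blast
    then have "(F ** P) *v x = 0 *v x" for x by (simp add: matrix_vector_mul_assoc)
    then show ?thesis using matrix_eq by blast
  qed
  have PTF: "?PT ** F = 0"
  proof -
    have "transpose (F ** P) = 0" unfolding FP by (simp add: transpose_def vec_eq_iff)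
    then show ?thesis by (simp add: matrix_transpose_mul sym)
  qed
  \<comment> \<open>Injectivity of the compression on the range of \<open>P\<close> becomes a
    quantitative bound \<open>c1\<close>, since the range is a finite-dimensional subspace.\<close>
  have "inj_on ((*v) (?PT ** D ** P)) (range ((*v) P))"
    using inv by (simp add: compression_invertible_def bij_betw_def)
  moreover have "0 \<in> range ((*v) P)" by (metis matrix_vector_mult_0_right rangeI)
  ultimately have "p = 0" if "p \<in> range ((*v) P)" "(?PT ** D ** P) *v p = 0" for p
    using that by (metis inj_onD matrix_vector_mult_0_right)
  then obtain c1 where c1: "0 < c1"
    "\<And>p. p \<in> range ((*v) P) \<Longrightarrow> c1 * norm p \<le> norm ((?PT ** D ** P) *v p)"
    using matrix_bounded_below_on[OF subspace_range_matrix] by metis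
  \<comment> \<open>The kernel of \<open>F\<close> is the range of \<open>P\<close>, which meets the
    complementary range of \<open>mat 1 - P\<close> only in 0; this yields the second bound
    \<open>c2\<close>.\<close>
  have "w = 0" if w: "w \<in> range ((*v) (mat 1 - P))" and F: "F *v w = 0" for w
  proof -
    have "P *v w = w" using F ker by (intro Pp) auto
    moreover obtain x where "w = x - P *v x" using w by (auto simp: matrix_vector_mult_diff_rdistrib)
    then have "P *v w = 0" by (simp add: matrix_vector_mult_diff_distrib matrix_vector_mul_assoc proj)
    ultimately show ?thesis by simp
  qed
  then obtain c2 where c2: "0 < c2"
    "\<And>w. w \<in> range ((*v) (mat 1 - P)) \<Longrightarrow> c2 * norm w \<le> norm (F *v w)"
    using matrix_bounded_below_on[OF subspace_range_matrix] by metis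
  define a where "a = opnorm ?PT"
  define b where "b = opnorm (?PT ** D)"
  define \<delta> where "\<delta> = opnorm D"
  have nn: "0 \<le> a" "0 \<le> b" "0 \<le> \<delta>" by (simp_all add: a_def b_def \<delta>_def opnorm_nonneg)
  \<comment> \<open>Here \<open>y\<close> denotes the image of \<open>x\<close>. The equation tested
    with the transpose of \<open>P\<close> gives
    \<open>c1 * norm p \<le> a * norm y + b * norm q\<close>. Substituted into
    \<open>F q = \<epsilon> (y - D x)\<close>, it leaves
    \<open>c2 * norm q \<le> \<epsilon> * (K1 * norm y + K2 * norm q)\<close>. Absorbing the last
    term into half of the left-hand side produces \<open>K3\<close>, and adding the bounds for
    \<open>p\<close> and \<open>q\<close> produces \<open>K\<close>.\<close>
  define K1 where "K1 = 1 + \<delta> * a / c1"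
  define K2 where "K2 = \<delta> * b / c1 + \<delta>"
  define K3 where "K3 = 2 * K1 / c2"
  define K where "K = (a + b * K3) / c1 + K3"
  have K: "0 < K1" "0 \<le> K2" "0 < K3" "0 < K"
  proof -
    show "0 < K1" using nn c1(1) by (simp add: K1_def add_pos_nonneg)
    then show "0 < K3" using c2(1) by (simp add: K3_def)
    then show "0 < K" using nn c1(1) by (simp add: K_def add_nonneg_pos)
    show "0 \<le> K2" using nn c1(1) by (simp add: K2_def)
  qed
  have "\<forall>\<^sub>F \<epsilon> in at_right 0. \<forall>x. (1/K) * norm x \<le> norm (((1/\<epsilon>) *\<^sub>R F + D) *v x)"
  \<comment> \<open>The bound 1 replaces \<epsilon> \<open>K1\<close> by \<open>K1\<close>; the
    other bound makes \<epsilon> \<open>K2\<close> at most \<open>c2 / 2\<close>, so that the term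
    in \<open>q\<close> can be absorbed.\<close>
  proof (rule eventually_at_rightI[of 0 "min 1 (c2 / (2 * (K2 + 1)))"])
    fix \<epsilon> assume \<epsilon>: "\<epsilon> \<in> {0<..<min 1 (c2 / (2 * (K2 + 1)))}"
    then have "\<epsilon> * (K2 + 1) < c2 / 2" using K(2) by (simp add: field_simps)
    then have small: "\<epsilon> * K2 \<le> c2 / 2" using \<epsilon> by (simp add: distrib_left)
    show "\<forall>x. (1/K) * norm x \<le> norm (((1/\<epsilon>) *\<^sub>R F + D) *v x)"
    proof
      fix x
      define p where "p = P *v x"
      define q where "q = x - P *v x"
      define y where "y = ((1/\<epsilon>) *\<^sub>R F + D) *v x"
      have x: "x = p + q" by (simp add: p_def q_def)
      have p: "p \<in> range ((*v) P)" by (simp add: p_def)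
      have q: "q \<in> range ((*v) (mat 1 - P))"
        by (auto simp: q_def matrix_vector_mult_diff_rdistrib intro!: image_eqI[of _ _ x])
      have y: "y = (1/\<epsilon>) *\<^sub>R (F *v x) + D *v x"
        by (simp add: y_def matrix_vector_mult_add_rdistrib scaleR_matrix_vector_assoc[symmetric])
      have "?PT *v y = ?PT *v (D *v x)"
        using PTF by (simp add: y matrix_vector_right_distrib matrix_vector_mult_scaleR matrix_vector_mul_assoc)
      then have "(?PT ** D) *v p = ?PT *v y - (?PT ** D) *v q"
        by (simp add: x matrix_vector_right_distrib matrix_vector_mul_assoc)
      moreover have "(?PT ** D ** P) *v p = (?PT ** D) *v p"
        using Pp[OF p] by (metis matrix_vector_mul_assoc)
      ultimately have "c1 * norm p \<le> norm (?PT *v y - (?PT ** D) *v q)"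
        using c1(2)[OF p] by simp
      also have "\<dots> \<le> a * norm y + b * norm q"
        using norm_triangle_ineq4[of "?PT *v y" "(?PT ** D) *v q"] opnorm_bound[of ?PT y]
          opnorm_bound[of "?PT ** D" q] by (simp add: a_def b_def)
      finally have p_le: "norm p \<le> (a * norm y + b * norm q) / c1"
        using c1(1) by (simp add: field_simps)
      have "F *v x = F *v q"
        using p ker by (auto simp: x matrix_vector_right_distrib)
      then have "F *v q = \<epsilon> *\<^sub>R (y - D *v x)"
        using \<epsilon> by (simp add: y)
      then have "c2 * norm q \<le> \<epsilon> * norm (y - D *v x)"
        using c2(2)[OF q] \<epsilon> by simp
      also have "\<dots> \<le> \<epsilon> * (norm y + \<delta> * (norm p + norm q))"
      proof (intro mult_left_mono)
        have "norm (D *v x) \<le> \<delta> * norm x" using opnorm_bound[of D x] by (simp add: \<delta>_def)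
        also have "\<dots> \<le> \<delta> * (norm p + norm q)"
          using nn(3) norm_triangle_ineq[of p q] by (intro mult_left_mono) (auto simp: x)
        finally show "norm (y - D *v x) \<le> norm y + \<delta> * (norm p + norm q)"
          using norm_triangle_ineq4[of y "D *v x"] by linarith
      qed (use \<epsilon> in auto)
      also have "\<dots> \<le> \<epsilon> * (norm y + \<delta> * ((a * norm y + b * norm q) / c1 + norm q))"
        using p_le nn(3) \<epsilon> by (intro mult_left_mono add_mono) auto
      also have "\<dots> = \<epsilon> * K1 * norm y + (\<epsilon> * K2) * norm q"
        using c1(1) by (simp add: K1_def K2_def field_simps)
      also have "\<dots> \<le> K1 * norm y + (c2 / 2) * norm q"
        using small \<epsilon> K(1) by (intro add_mono mult_right_mono) (auto simp: mult_le_cancel_right1)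
      finally have q_le: "norm q \<le> K3 * norm y"
        using c2(1) by (simp add: K3_def field_simps)
      have "norm x \<le> norm p + norm q" using norm_triangle_ineq[of p q] by (simp add: x)
      also have "\<dots> \<le> (a * norm y + b * (K3 * norm y)) / c1 + K3 * norm y"
        using p_le q_le nn c1(1)
        by (intro add_mono order_trans[OF p_le] divide_right_mono mult_left_mono) auto
      also have "\<dots> = K * norm y" using c1(1) by (simp add: K_def field_simps)
      finally show "(1/K) * norm x \<le> norm (((1/\<epsilon>) *\<^sub>R F + D) *v x)"
        using K(4) by (simp add: y_def field_simps)
    qed
  qed (use K(2) c2(1) in auto)
  then show ?thesis using K(4) by (intro exI[of _ "1/K"]) simp
qed

section \<open>Norms of block diagonal matrices\<close>

lemma block_diag_vec:
  "(block_diag A *v x) $ (d, i) = (A d *v (\<chi> j. x $ (d, j))) $ i"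
proof -
  have "(block_diag A *v x) $ (d, i) =
      (\<Sum>q\<in>UNIV \<times> UNIV. (if d = fst q then A d $ i $ snd q else 0) * x $ q)"
    by (simp add: block_diag_def matrix_vector_mult_def cong del: if_weak_cong)
  also have "\<dots> = (\<Sum>d'\<in>UNIV. \<Sum>j\<in>UNIV. (if d = d' then A d $ i $ j else 0) * x $ (d', j))"
    by (simp add: sum.cartesian_product case_prod_beta)
  also have "\<dots> = (\<Sum>d'\<in>UNIV. if d = d' then \<Sum>j\<in>UNIV. A d $ i $ j * x $ (d', j) else 0)"
    by (intro sum.cong) auto
  finally show ?thesis by (simp add: matrix_vector_mult_def)
qed

text \<open>The Euclidean norm is compared with the sum of the absolute components twice, once for
  the output and once for each slice of the input. The resulting constant is not sharp, but it
  depends on the dimensions alone and hence not on \<epsilon>.\<close>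

lemma opnorm_block_diag:
  fixes A :: "real^'k^'k"
  shows "opnorm (block_diag (\<lambda>d::'d::finite. A)) \<le> real (CARD('d \<times> 'k) * CARD('k)) * opnorm A"
proof (rule opnorm_le)
  fix x :: "real^('d \<times> 'k)"
  have slice: "norm (\<chi> j. x $ (d, j)) \<le> real CARD('k) * norm x" for d
  proof -
    have "norm (\<chi> j. x $ (d, j)) \<le> (\<Sum>j\<in>UNIV. \<bar>(\<chi> j. x $ (d, j)) $ j\<bar>)"
      by (rule norm_le_l1_cart)
    also have "\<dots> \<le> (\<Sum>j::'k\<in>UNIV. norm x)"
      by (intro sum_mono) (simp add: component_le_norm_cart)
    finally show ?thesis by simp
  qed
  have "\<bar>(block_diag (\<lambda>d. A) *v x) $ q\<bar> \<le> opnorm A * (real CARD('k) * norm x)" for q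
  proof -
    obtain d i where q: "q = (d, i)" by fastforce
    have "\<bar>(block_diag (\<lambda>d. A) *v x) $ q\<bar> \<le> norm (A *v (\<chi> j. x $ (d, j)))"
      unfolding q block_diag_vec by (rule component_le_norm_cart)
    also have "\<dots> \<le> opnorm A * norm (\<chi> j. x $ (d, j))" by (rule opnorm_bound)
    also have "\<dots> \<le> opnorm A * (real CARD('k) * norm x)"
      by (intro mult_left_mono slice opnorm_nonneg)
    finally show ?thesis .
  qed
  then have "(\<Sum>q\<in>UNIV. \<bar>(block_diag (\<lambda>d. A) *v x) $ q\<bar>) \<le>
      (\<Sum>q::'d \<times> 'k\<in>UNIV. opnorm A * (real CARD('k) * norm x))"
    by (rule sum_mono)
  then show "norm (block_diag (\<lambda>d. A) *v x) \<le> real (CARD('d \<times> 'k) * CARD('k)) * opnorm A * norm x"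
    using norm_le_l1_cart[of "block_diag (\<lambda>d. A) *v x"] by (simp add: mult_ac)
qed

lemma matrix_bigo_block_diag:
  assumes "matrix_bigo k A"
  shows "matrix_bigo k (\<lambda>\<epsilon>. block_diag (\<lambda>d::'d::finite. A \<epsilon> :: real^'k^'k))"
proof -
  let ?N = "real (CARD('d \<times> 'k) * CARD('k))"
  obtain C where C: "C \<ge> 0" "\<forall>\<^sub>F \<epsilon> in at_right 0. opnorm (A \<epsilon>) \<le> C * \<epsilon> powi k"
    using assms by (auto simp: matrix_bigo_def)
  from C(2) have "\<forall>\<^sub>F \<epsilon> in at_right 0. opnorm (block_diag (\<lambda>d::'d. A \<epsilon>)) \<le> (?N * C) * \<epsilon> powi k"
  proof eventually_elim
    case (elim \<epsilon>)
    have "?N * opnorm (A \<epsilon>) \<le> ?N * (C * \<epsilon> powi k)"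
      using elim by (intro mult_left_mono) auto
    with opnorm_block_diag[of "A \<epsilon>", where 'd = 'd] show ?case
      by (simp only: mult.assoc[of ?N])
  qed
  then show ?thesis using C(1) unfolding matrix_bigo_def by (intro exI[of _ "?N * C"]) simp
qed

section \<open>Lipschitz functions and polynomials\<close>

lemma lipschitz_on_mult_bounded:
  fixes f g :: "'a::metric_space \<Rightarrow> real"
  assumes f: "L-lipschitz_on K f" and g: "M-lipschitz_on K g"
    and bf: "\<And>x. x \<in> K \<Longrightarrow> \<bar>f x\<bar> \<le> A" and bg: "\<And>x. x \<in> K \<Longrightarrow> \<bar>g x\<bar> \<le> B"
    and A: "0 \<le> A" and B: "0 \<le> B"
  shows "(A * M + B * L)-lipschitz_on K (\<lambda>x. f x * g x)"
proof (rule lipschitz_onI)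
  show "0 \<le> A * M + B * L"
    using A B lipschitz_on_nonneg[OF f] lipschitz_on_nonneg[OF g] by simp
  fix x y assume xy: "x \<in> K" "y \<in> K"
  have "dist (f x * g x) (f y * g y) = \<bar>f x * (g x - g y) + g y * (f x - f y)\<bar>"
    by (simp add: dist_real_def algebra_simps)
  also have "\<dots> \<le> \<bar>f x\<bar> * \<bar>g x - g y\<bar> + \<bar>g y\<bar> * \<bar>f x - f y\<bar>"
    by (metis abs_mult abs_triangle_ineq)
  also have "\<dots> \<le> A * (M * dist x y) + B * (L * dist x y)"
    using bf[OF xy(1)] bg[OF xy(2)] lipschitz_onD[OF f xy] lipschitz_onD[OF g xy] A B
    by (intro add_mono mult_mono) (auto simp: dist_real_def)
  finally show "dist (f x * g x) (f y * g y) \<le> (A * M + B * L) * dist x y"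
    by (simp add: algebra_simps)
qed

text \<open>A product of Lipschitz functions is Lipschitz if the factors are bounded as well.
  Carrying both properties gives a class closed under sums and products, which therefore contains
  the polynomials on a bounded set.\<close>

definition lip_bdd_on :: "'a::metric_space set \<Rightarrow> ('a \<Rightarrow> real) \<Rightarrow> bool" where
  "lip_bdd_on K f \<longleftrightarrow> (\<exists>L. L-lipschitz_on K f) \<and> (\<exists>A. \<forall>x\<in>K. \<bar>f x\<bar> \<le> A)"

lemma lip_bdd_on_const: "lip_bdd_on K (\<lambda>x. c)"
  by (auto simp: lip_bdd_on_def intro: lipschitz_on_constant)

lemma lip_bdd_on_add:
  assumes "lip_bdd_on K f" "lip_bdd_on K g"
  shows "lip_bdd_on K (\<lambda>x. f x + g x)"
proof -
  obtain L M A B where *: "L-lipschitz_on K f" "M-lipschitz_on K g"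
    "\<forall>x\<in>K. \<bar>f x\<bar> \<le> A" "\<forall>x\<in>K. \<bar>g x\<bar> \<le> B"
    using assms by (auto simp: lip_bdd_on_def)
  then have "\<forall>x\<in>K. \<bar>f x + g x\<bar> \<le> A + B" by fastforce
  with lipschitz_on_add[OF *(1,2)] show ?thesis by (auto simp: lip_bdd_on_def)
qed

lemma lip_bdd_on_mult:
  assumes "lip_bdd_on K f" "lip_bdd_on K g"
  shows "lip_bdd_on K (\<lambda>x. f x * g x)"
proof -
  obtain L M A B where *: "L-lipschitz_on K f" "M-lipschitz_on K g"
    "\<forall>x\<in>K. \<bar>f x\<bar> \<le> A" "\<forall>x\<in>K. \<bar>g x\<bar> \<le> B"
    using assms by (auto simp: lip_bdd_on_def)
  have "(\<bar>A\<bar> * M + \<bar>B\<bar> * L)-lipschitz_on K (\<lambda>x. f x * g x)"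
    by (rule lipschitz_on_mult_bounded[OF *(1,2)]) (use *(3,4) in fastforce)+
  moreover have "\<bar>f x * g x\<bar> \<le> \<bar>A\<bar> * \<bar>B\<bar>" if "x \<in> K" for x
    unfolding abs_mult by (rule mult_mono) (use *(3,4) that in fastforce)+
  ultimately show ?thesis by (auto simp: lip_bdd_on_def)
qed

lemma lip_bdd_on_sum:
  "(\<And>i. i \<in> I \<Longrightarrow> lip_bdd_on K (f i)) \<Longrightarrow> lip_bdd_on K (\<lambda>x. \<Sum>i\<in>I. f i x)"
  by (induction I rule: infinite_finite_induct) (auto intro: lip_bdd_on_const lip_bdd_on_add)

lemma lip_bdd_on_prod:
  "(\<And>i. i \<in> I \<Longrightarrow> lip_bdd_on K (f i)) \<Longrightarrow> lip_bdd_on K (\<lambda>x. \<Prod>i\<in>I. f i x)"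
  by (induction I rule: infinite_finite_induct) (auto intro: lip_bdd_on_const lip_bdd_on_mult)

lemma lip_bdd_on_power: "lip_bdd_on K f \<Longrightarrow> lip_bdd_on K (\<lambda>x. f x ^ k)"
  by (induction k) (auto intro: lip_bdd_on_const lip_bdd_on_mult)

lemma lip_bdd_on_component:
  fixes K :: "(real^'n) set"
  assumes "bounded K"
  shows "lip_bdd_on K (\<lambda>x. x $ i)"
proof -
  have "1-lipschitz_on K (\<lambda>x. x $ i)"
    by (auto intro!: lipschitz_onI simp: dist_vec_nth_le)
  moreover obtain A where "\<forall>x\<in>K. norm x \<le> A"
    using assms by (auto simp: bounded_iff)
  then have "\<forall>x\<in>K. \<bar>x $ i\<bar> \<le> A"
    using component_le_norm_cart order_trans by blast
  ultimately show ?thesis by (auto simp: lip_bdd_on_def)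
qed

lemma lip_bdd_on_poly_fun:
  fixes K :: "(real^'n) set"
  assumes "poly_fun r p" "bounded K"
  shows "lip_bdd_on K p"
proof -
  obtain c where "\<forall>y. p y = (\<Sum>a | sum a (UNIV::'n set) \<le> r. c a * (\<Prod>i\<in>UNIV. (y $ i) ^ a i))"
    using assms(1) by (auto simp: poly_fun_def)
  then have p: "p = (\<lambda>y. \<Sum>a | sum a (UNIV::'n set) \<le> r. c a * (\<Prod>i\<in>UNIV. (y $ i) ^ a i))"
    by auto
  show ?thesis
    unfolding p
    by (intro lip_bdd_on_sum lip_bdd_on_mult lip_bdd_on_const lip_bdd_on_prod
        lip_bdd_on_power lip_bdd_on_component assms)
qed

lemma poly_fun_add:
  fixes p q :: "real^'n \<Rightarrow> real"
  assumes "poly_fun r p" "poly_fun r q"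
  shows "poly_fun r (\<lambda>y. p y + q y)"
proof -
  obtain b c where
    "\<forall>y. p y = (\<Sum>a | sum a (UNIV::'n set) \<le> r. b a * (\<Prod>i\<in>UNIV. (y $ i) ^ a i))"
    "\<forall>y. q y = (\<Sum>a | sum a (UNIV::'n set) \<le> r. c a * (\<Prod>i\<in>UNIV. (y $ i) ^ a i))"
    using assms by (auto simp: poly_fun_def)
  then show ?thesis
    by (auto simp: poly_fun_def distrib_right sum.distrib intro!: exI[of _ "\<lambda>a. b a + c a"])
qed

lemma poly_fun_mult:
  fixes p :: "real^'n \<Rightarrow> real"
  assumes "poly_fun r p"
  shows "poly_fun r (\<lambda>y. k * p y)"
proof -
  obtain b where
    "\<forall>y. p y = (\<Sum>a | sum a (UNIV::'n set) \<le> r. b a * (\<Prod>i\<in>UNIV. (y $ i) ^ a i))"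
    using assms by (auto simp: poly_fun_def)
  then show ?thesis
    by (auto simp: poly_fun_def sum_distrib_left mult.assoc intro!: exI[of _ "\<lambda>a. k * b a"])
qed

lemma poly_fun_zero: "poly_fun r (\<lambda>y. 0)"
  by (auto simp: poly_fun_def intro!: exI[of _ "\<lambda>a. 0"])

lemma poly_fun_sum:
  assumes "\<And>i. i \<in> I \<Longrightarrow> poly_fun r (p i)"
  shows "poly_fun r (\<lambda>y. \<Sum>i\<in>I. p i y)"
  using assms
  by (induction I rule: infinite_finite_induct) (auto intro: poly_fun_zero poly_fun_add)

section \<open>Lipschitz bounds for inverse element maps and along segments\<close>

lemma jac_has_derivative:
  assumes "\<phi> differentiable_on V" "open V" "y \<in> V"
  shows "(\<phi> has_derivative (*v) (jac \<phi> y)) (at y)"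
proof -
  have "\<phi> differentiable at y"
    using assms by (metis at_within_open differentiable_on_def)
  then have *: "(\<phi> has_derivative frechet_derivative \<phi> (at y)) (at y)"
    by (simp add: frechet_derivative_works)
  then have "(*v) (jac \<phi> y) = frechet_derivative \<phi> (at y)"
    unfolding jac_def
    by (metis has_derivative_linear linear_matrix_vector_mul_eq matrix_works ext)
  with * show ?thesis by simp
qed

text \<open>By invariance of domain the image of the neighbourhood is open, and there the inverse is
  continuously differentiable with derivative \<open>matrix_inv (jac \<phi> y)\<close>. Since a
  curved element need not be convex, the mean value inequality cannot be used across it; a local
  Lipschitz bound is obtained and then made uniform by compactness.\<close>

lemma C1_embedding_near_inverse_lipschitz:
  fixes \<phi> :: "real^'n \<Rightarrow> real^'n"
  assumes emb: "C1_embedding_near K \<phi>" and K: "compact K"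
  shows "\<exists>L. L-lipschitz_on (\<phi> ` K) (inv_into K \<phi>)"
proof -
  obtain V where V: "open V" "K \<subseteq> V" "inj_on \<phi> V" "\<phi> differentiable_on V"
    "continuous_on V (jac \<phi>)" "\<And>y. y \<in> V \<Longrightarrow> det (jac \<phi> y) \<noteq> 0"
    using emb by (auto simp: C1_embedding_near_def)
  define \<psi> where "\<psi> = inv_into V \<phi>"
  have \<psi>: "\<psi> (\<phi> y) = y" if "y \<in> V" for y
    using V(3) that by (simp add: \<psi>_def)
  have cont: "continuous_on V \<phi>"
    by (rule differentiable_imp_continuous_on[OF V(4)])
  have op: "open (\<phi> ` V)"
    by (rule invariance_of_domain[OF cont V(1) V(3)])
  have der: "(\<psi> has_derivative (*v) (matrix_inv (jac \<phi> y))) (at (\<phi> y))" if "y \<in> V" for y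
  proof (rule has_derivative_inverse_on[where S = V and f = \<phi> and f' = "\<lambda>y. (*v) (jac \<phi> y)" and
        g' = "\<lambda>y. (*v) (matrix_inv (jac \<phi> y))"])
    show "(\<phi> has_derivative (*v) (jac \<phi> x)) (at x)" if "x \<in> V" for x
      by (rule jac_has_derivative[OF V(4,1) that])
    show "(*v) (jac \<phi> y) \<circ> (*v) (matrix_inv (jac \<phi> y)) = id"
      using V(6)[OF that]
      by (auto simp: fun_eq_iff matrix_vector_mul_assoc invertible_det_nz matrix_inv_right)
  qed (use V(1) \<psi> that in auto)
  define D where "D x = matrix_inv (jac \<phi> (\<psi> x))" for x
  have cont\<psi>: "continuous_on (\<phi> ` V) \<psi>"
    using has_derivative_continuous[OF der] by (auto intro!: continuous_at_imp_continuous_on)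
  have contD: "continuous_on (\<phi> ` V) D"
    unfolding D_def
  proof (rule continuous_on_compose2[OF _ cont\<psi>])
    show "continuous_on V (\<lambda>x. matrix_inv (jac \<phi> x))"
      by (rule continuous_on_matrix_inv[OF V(5,6)])
  qed (use \<psi> in auto)
  \<comment> \<open>\<open>local_lipschitz\<close> is the notion for time-dependent vector fields;
    the time variable is a dummy.\<close>
  have "local_lipschitz UNIV (\<phi> ` V) (\<lambda>t::real. \<psi>)"
  proof (rule c1_implies_local_lipschitz[where f' = "\<lambda>z. Blinfun ((*v) (D (snd z)))"])
    show "(\<psi> has_derivative blinfun_apply (Blinfun ((*v) (D (snd (t, x)))))) (at x)"
      if "x \<in> \<phi> ` V" for t :: real and x
      using that der \<psi> by (auto simp: bounded_linear_Blinfun_apply D_def)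
    show "continuous_on (UNIV \<times> \<phi> ` V) (\<lambda>z::real \<times> (real^'n). Blinfun ((*v) (D (snd z))))"
    proof (rule continuous_on_blinfun_componentwise)
      fix i :: "real^'n"
      have "continuous_on (UNIV \<times> \<phi> ` V) (\<lambda>z::real \<times> (real^'n). D (snd z))"
        by (rule continuous_on_compose2[OF contD continuous_on_snd[OF continuous_on_id]]) auto
      then show "continuous_on (UNIV \<times> \<phi> ` V)
          (\<lambda>z::real \<times> (real^'n). blinfun_apply (Blinfun ((*v) (D (snd z)))) i)"
        by (auto simp: bounded_linear_Blinfun_apply matrix_vector_mult_def
            intro!: continuous_intros)
    qed
  qed (use op in auto)
  \<comment> \<open>Time is reduced to one point, so that the parameter set is compact too.\<close>
  then have "local_lipschitz {0} (\<phi> ` K) (\<lambda>t::real. \<psi>)"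
    by (rule local_lipschitz_subset) (use V(2) in auto)
  moreover have "compact (\<phi> ` K)"
    by (rule compact_continuous_image[OF continuous_on_subset[OF cont V(2)] K])
  ultimately obtain L where "L-lipschitz_on (\<phi> ` K) \<psi>"
    using local_lipschitz_compact_implies_lipschitz[where X = "\<phi> ` K" and T = "{0::real}" and f = "\<lambda>t. \<psi>"]
    by auto
  moreover have "inv_into K \<phi> x = \<psi> x" if "x \<in> \<phi> ` K" for x
    using that V(2) \<psi> inj_on_subset[OF V(3) V(2)] by auto
  ultimately have "L-lipschitz_on (\<phi> ` K) (inv_into K \<phi>)"
    by (simp cong: lipschitz_on_cong)
  then show ?thesis ..
qed

text \<open>Induction over the number of pieces, jumping to the last point of the piece that contains \<open>a\<close>.\<close>

lemma lipschitz_closed_cover_interval: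
  fixes f :: "real \<Rightarrow> 'b::metric_space"
  assumes "finite \<C>" and "\<And>C. C \<in> \<C> \<Longrightarrow> closed C" and "{a..b} \<subseteq> \<Union>\<C>" and "a \<le> b"
    and "\<And>C. C \<in> \<C> \<Longrightarrow> L-lipschitz_on (C \<inter> {a..b}) f"
  shows "dist (f a) (f b) \<le> L * (b - a)"
  using assms
proof (induction "card \<C>" arbitrary: \<C> a rule: less_induct)
  case less
  from less.prems(3,4) obtain C where C: "C \<in> \<C>" "a \<in> C" by auto
  have L: "0 \<le> L" using less.prems(5)[OF C(1)] lipschitz_on_nonneg by blast
  define s where "s = Sup (C \<inter> {a..b})"
  have cpt: "compact (C \<inter> {a..b})"
    using less.prems(2)[OF C(1)] by (simp add: closed_Int_compact)
  have ne: "C \<inter> {a..b} \<noteq> {}" using C less.prems(4) by auto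
  have s: "s \<in> C" "a \<le> s" "s \<le> b"
    using closed_contains_Sup[OF ne] cpt compact_imp_closed[OF cpt]
    by (auto simp: s_def intro: bounded_imp_bdd_above compact_imp_bounded)
  have s_max: "t \<notin> C" if "s < t" "t \<le> b" for t
    using cSup_upper[of t "C \<inter> {a..b}"] that s(2) cpt
    by (auto simp: s_def bounded_imp_bdd_above compact_imp_bounded)
  \<comment> \<open>The interval may leave \<open>C\<close> between \<open>a\<close> and
    \<open>s\<close>; the Lipschitz bound on \<open>C\<close> is applied to the two end points
    only.\<close>
  have 1: "dist (f a) (f s) \<le> L * (s - a)"
    using lipschitz_onD[OF less.prems(5)[OF C(1)], of a s] C s less.prems(4)
    by (auto simp: dist_real_def)
  show ?case
  proof (cases "s = b")
    case True
    then show ?thesis using 1 by simp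
  next
    case False
    with s have sb: "s < b" by simp
    let ?\<D> = "\<C> - {C}"
    have cl: "closed (\<Union>?\<D>)" using less.prems(1,2) by (intro closed_Union) auto
    have "{s<..<b} \<subseteq> \<Union>?\<D>"
    proof
      fix t assume t: "t \<in> {s<..<b}"
      then have "t \<in> {a..b}" using s(2) by simp
      then have "t \<in> \<Union>\<C>" using less.prems(3) by blast
      with s_max[of t] t show "t \<in> \<Union>?\<D>" by auto
    qed
    then have "closure {s<..<b} \<subseteq> \<Union>?\<D>"
      by (rule closure_minimal[OF _ cl])
    then have cov: "{s..b} \<subseteq> \<Union>?\<D>" using sb by simp
    have "dist (f s) (f b) \<le> L * (b - s)"
    proof (rule less.hyps[OF _ _ _ cov s(3)])
      show "card ?\<D> < card \<C>" using C(1) less.prems(1) by (intro card_Diff1_less)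
      show "L-lipschitz_on (D \<inter> {s..b}) f" if "D \<in> ?\<D>" for D
        using that s by (intro lipschitz_on_subset[OF less.prems(5)[of D]]) auto
    qed (use less.prems in auto)
    then show ?thesis
      using 1 dist_triangle[of "f a" "f b" "f s"] by (simp add: algebra_simps)
  qed
qed

text \<open>Neither convexity of the pieces nor finitely many crossings are required, which matters
  because a segment can meet a curved element in infinitely many intervals.\<close>

lemma lipschitz_closed_cover_segment:
  fixes f :: "'a::real_normed_vector \<Rightarrow> 'b::metric_space"
  assumes fin: "finite \<C>" and cl: "\<And>C. C \<in> \<C> \<Longrightarrow> closed C" and cov: "closed_segment a b \<subseteq> \<Union>\<C>"
    and lip: "\<And>C. C \<in> \<C> \<Longrightarrow> L-lipschitz_on (C \<inter> closed_segment a b) f"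
  shows "dist (f a) (f b) \<le> L * dist a b"
proof -
  define \<gamma> where "\<gamma> t = a + t *\<^sub>R (b - a)" for t :: real
  have \<gamma>_seg: "\<gamma> t \<in> closed_segment a b" if "t \<in> {0..1}" for t
    using that by (auto simp: \<gamma>_def closed_segment_def algebra_simps intro!: exI[of _ t])
  have cont: "continuous_on UNIV \<gamma>"
    unfolding \<gamma>_def by (intro continuous_intros)
  have "dist ((f \<circ> \<gamma>) 0) ((f \<circ> \<gamma>) 1) \<le> (L * dist a b) * (1 - 0)"
  proof (rule lipschitz_closed_cover_interval[where \<C> = "(\<lambda>C. \<gamma> -` C) ` \<C>"])
    show "closed C" if C: "C \<in> (\<lambda>C. \<gamma> -` C) ` \<C>" for C
    proof -
      obtain D where D: "C = \<gamma> -` D" "D \<in> \<C>" using C by auto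
      show ?thesis
        unfolding D(1) by (rule closed_vimage[OF cl[OF D(2)] cont])
    qed
    show "{0..1} \<subseteq> \<Union> ((\<lambda>C. \<gamma> -` C) ` \<C>)"
      using \<gamma>_seg cov by fastforce
    fix C assume "C \<in> (\<lambda>C. \<gamma> -` C) ` \<C>"
    then obtain D where D: "C = \<gamma> -` D" "D \<in> \<C>" by auto
    have "(dist a b)-lipschitz_on (C \<inter> {0..1}) \<gamma>"
    proof (rule lipschitz_onI)
      fix s t :: real
      have "\<gamma> s - \<gamma> t = (s - t) *\<^sub>R (b - a)" by (simp add: \<gamma>_def algebra_simps)
      then show "dist (\<gamma> s) (\<gamma> t) \<le> dist a b * dist s t"
        by (simp add: dist_norm norm_minus_commute mult.commute)
    qed simp
    moreover have "L-lipschitz_on (\<gamma> ` (C \<inter> {0..1})) f"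
      using D \<gamma>_seg by (intro lipschitz_on_subset[OF lip[OF D(2)]]) auto
    ultimately show "(L * dist a b)-lipschitz_on (C \<inter> {0..1}) (f \<circ> \<gamma>)"
      by (rule lipschitz_on_compose)
  qed (use fin in auto)
  then show ?thesis by (simp add: \<gamma>_def)
qed

section \<open>Integrals over flat patches\<close>

definition prism :: "(real^'n) set \<Rightarrow> real^'n \<Rightarrow> (real^'n) set" where
  "prism p \<nu> = {y + t *\<^sub>R \<nu> | y t. y \<in> p \<and> 0 \<le> t \<and> t \<le> 1}"

text \<open>For a unit vector \<open>\<nu>\<close> this is the orthogonal projection onto the
  hyperplane \<open>\<nu> \<bullet> x = c\<close>.\<close>

definition foot :: "real \<Rightarrow> real^'n \<Rightarrow> real^'n \<Rightarrow> real^'n" where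
  "foot c \<nu> x = x - (\<nu> \<bullet> x - c) *\<^sub>R \<nu>"

lemma prism_eq_image: "prism p \<nu> = (\<lambda>(y, t). y + t *\<^sub>R \<nu>) ` (p \<times> {0..1})"
  by (fastforce simp: prism_def)

locale flat_patch =
  fixes p :: "(real^'n) set" and \<nu> :: "real^'n" and c :: real
  assumes compact: "compact p" and convex: "convex p" and nonempty: "p \<noteq> {}"
    and unit: "norm \<nu> = 1" and flat: "\<And>y. y \<in> p \<Longrightarrow> \<nu> \<bullet> y = c"
    and aff_dim: "aff_dim p = int CARD('n) - 1"
begin

lemma compact_prism: "compact (prism p \<nu>)"
  unfolding prism_eq_image
  by (intro compact_continuous_image compact_Times compact)
    (auto simp: case_prod_beta intro!: continuous_intros)

lemma convex_prism: "convex (prism p \<nu>)"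
proof -
  have "linear (\<lambda>(y, t). y + t *\<^sub>R \<nu>)"
    by (rule linearI) (auto simp: algebra_simps)
  then show ?thesis
    unfolding prism_eq_image by (intro convex_linear_image convex_Times convex) auto
qed

lemma foot_prism: "x \<in> prism p \<nu> \<Longrightarrow> foot c \<nu> x \<in> p"
  using unit by (auto simp: prism_def foot_def inner_add_right flat algebra_simps norm_eq_1)

lemma foot_self: "y \<in> p \<Longrightarrow> foot c \<nu> y = y"
  by (simp add: foot_def flat)

lemma subset_prism: "p \<subseteq> prism p \<nu>"
  by (force simp: prism_def)

text \<open>A point off the hyperplane raises the affine dimension of the patch from n - 1 to n, and
  a convex set of full dimension has interior points.\<close>

lemma interior_prism: "interior (prism p \<nu>) \<noteq> {}"
proof -
  obtain y where y: "y \<in> p" using nonempty by auto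
  have "affine {x. \<nu> \<bullet> x = c}" by (rule affine_hyperplane)
  then have "affine hull p \<subseteq> {x. \<nu> \<bullet> x = c}"
    by (intro hull_minimal) (auto simp: flat)
  moreover have "\<nu> \<bullet> (y + \<nu>) \<noteq> c"
    using unit flat[OF y] by (simp add: inner_add_right norm_eq_1)
  ultimately have "aff_dim (insert (y + \<nu>) p) = int CARD('n)"
    by (auto simp: aff_dim_insert aff_dim)
  moreover have "insert (y + \<nu>) p \<subseteq> prism p \<nu>"
  proof -
    have "\<exists>y' t. y + \<nu> = y' + t *\<^sub>R \<nu> \<and> y' \<in> p \<and> 0 \<le> t \<and> t \<le> 1"
      using y by (intro exI[of _ y] exI[of _ "1::real"]) simp
    then show ?thesis using subset_prism by (simp add: prism_def)
  qed
  ultimately have "int CARD('n) \<le> aff_dim (prism p \<nu>)"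
    by (metis aff_dim_subset)
  then have "aff_dim (prism p \<nu>) = int DIM(real^'n)"
    using aff_dim_le_DIM[of "prism p \<nu>"] by simp
  then have "affine hull (prism p \<nu>) = UNIV"
    using aff_dim_eq_full by blast
  then show ?thesis
    using rel_interior_interior rel_interior_eq_empty[OF convex_prism] subset_prism nonempty
    by fastforce
qed

text \<open>The point chosen by \<open>SOME\<close> does not matter, because \<open>\<nu>\<close> is
  constant on the patch.\<close>

lemma flat_integral_eq: "flat_integral p \<nu> h = (LINT x:prism p \<nu>|lebesgue. h (foot c \<nu> x))"
proof -
  have "\<nu> \<bullet> (SOME y. y \<in> p) = c"
    using flat nonempty by (simp add: some_in_eq)
  then show ?thesis
    by (simp add: flat_integral_def prism_def foot_def)
qed

lemma continuous_on_foot: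
  assumes "continuous_on p h"
  shows "continuous_on (prism p \<nu>) (\<lambda>x. h (foot c \<nu> x))"
proof (rule continuous_on_compose2[OF assms])
  show "continuous_on (prism p \<nu>) (foot c \<nu>)"
    unfolding foot_def[abs_def] by (intro continuous_intros)
qed (auto simp: foot_prism)

lemma integrable_foot:
  fixes h :: "real^'n \<Rightarrow> real"
  assumes "continuous_on p h"
  shows "set_integrable lebesgue (prism p \<nu>) (\<lambda>x. h (foot c \<nu> x))"
proof -
  have "integrable lborel (\<lambda>x. indicator (prism p \<nu>) x *\<^sub>R h (foot c \<nu> x))"
    by (rule borel_integrable_compact[OF compact_prism continuous_on_foot[OF assms]])
  then show ?thesis
    unfolding set_integrable_def by (subst integrable_completion) auto
qed

lemma flat_integral_cong:
  assumes "\<And>y. y \<in> p \<Longrightarrow> h y = h' y"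
  shows "flat_integral p \<nu> h = flat_integral p \<nu> h'"
  unfolding flat_integral_eq
  by (rule set_lebesgue_integral_cong)
    (use assms foot_prism compact_prism in \<open>auto simp: lmeasurable_compact fmeasurableD\<close>)

lemma flat_integral_mult: "flat_integral p \<nu> (\<lambda>y. a * h y) = a * flat_integral p \<nu> h"
  unfolding flat_integral_eq by simp

lemma flat_integral_add:
  assumes "continuous_on p h" "continuous_on p h'"
  shows "flat_integral p \<nu> (\<lambda>y. h y + h' y) = flat_integral p \<nu> h + flat_integral p \<nu> h'"
  unfolding flat_integral_eq
  by (rule set_integral_add) (intro integrable_foot assms)+

lemma flat_integral_zero: "flat_integral p \<nu> (\<lambda>y. 0) = 0"
  unfolding flat_integral_eq by (simp add: set_lebesgue_integral_def)

lemma flat_integral_sum: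
  assumes "\<And>i. i \<in> I \<Longrightarrow> continuous_on p (h i)"
  shows "flat_integral p \<nu> (\<lambda>y. \<Sum>i\<in>I. h i y) = (\<Sum>i\<in>I. flat_integral p \<nu> (h i))"
  using assms
proof (induction I rule: infinite_finite_induct)
  case (insert i I)
  then show ?case
    by (simp add: flat_integral_add continuous_on_sum)
qed (simp_all add: flat_integral_zero)

lemma flat_integral_nonneg:
  assumes "\<And>y. y \<in> p \<Longrightarrow> 0 \<le> h y"
  shows "0 \<le> flat_integral p \<nu> h"
  unfolding flat_integral_eq set_lebesgue_integral_def
  by (rule Bochner_Integration.integral_nonneg) (simp add: indicator_def assms foot_prism)

text \<open>The integrand vanishes almost everywhere in the interior of the prism. Its zero set is
  closed, so it contains that interior, then its closure, which is the whole prism by convexity, and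
  in particular the patch, which is only a null set for the volume integral.\<close>

lemma flat_integral_eq_0D:
  assumes h: "continuous_on p h" "\<And>y. y \<in> p \<Longrightarrow> 0 \<le> h y" and 0: "flat_integral p \<nu> h = 0"
    and y: "y \<in> p"
  shows "h y = 0"
proof -
  let ?f = "\<lambda>x. h (foot c \<nu> x)" and ?C = "{x \<in> prism p \<nu>. h (foot c \<nu> x) = 0}"
  have "AE x in lebesgue. indicator (prism p \<nu>) x *\<^sub>R ?f x = 0"
  proof (rule integral_nonneg_eq_0_iff_AE[THEN iffD1])
    show "integrable lebesgue (\<lambda>x. indicat_real (prism p \<nu>) x *\<^sub>R ?f x)"
      using integrable_foot[OF h(1)] by (simp add: set_integrable_def)
    show "AE x in lebesgue. 0 \<le> indicat_real (prism p \<nu>) x *\<^sub>R ?f x"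
      by (simp add: indicator_def h(2) foot_prism)
    show "LINT x|lebesgue. indicat_real (prism p \<nu>) x *\<^sub>R ?f x = 0"
      using 0 by (simp add: flat_integral_eq set_lebesgue_integral_def)
  qed
  then have ae: "AE x \<in> interior (prism p \<nu>) in lebesgue. x \<in> ?C"
    by (rule eventually_mono) (use interior_subset in \<open>auto simp: indicator_def split: if_splits\<close>)
  have "closed (?f -` {0} \<inter> prism p \<nu>)"
    by (intro continuous_on_closed_vimage[THEN iffD1, rule_format] continuous_on_foot h
        compact_imp_closed compact_prism) auto
  then have cl: "closed ?C" by (simp add: vimage_def Int_def conj_commute)
  have "interior (prism p \<nu>) \<subseteq> ?C"
    using mem_closed_if_AE_lebesgue_open[OF open_interior cl ae] by auto
  then have "closure (interior (prism p \<nu>)) \<subseteq> ?C"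
    using cl by (rule closure_minimal)
  moreover have "closure (interior (prism p \<nu>)) = prism p \<nu>"
    using convex_closure_interior[OF convex_prism interior_prism] compact_prism
    by (simp add: compact_imp_closed)
  ultimately show ?thesis
    using subset_prism y foot_self by auto
qed

end

section \<open>Traces on the mesh\<close>

text \<open>The part of membership in \<open>dg_space\<close> on which the traces depend.\<close>

definition piecewise_poly :: "('e, 'n::finite, 'k, 'd) dg_setup \<Rightarrow> (real^'n \<Rightarrow> real) \<Rightarrow> bool" where
  "piecewise_poly S u \<longleftrightarrow> (\<forall>\<kappa>\<in>elems S. \<exists>p. poly_fun (degr S) p \<and>
        (\<forall>y\<in>interior (refel S \<kappa>). u (emap S \<kappa> y) = p y))"

locale dg =
  fixes S :: "('e, 'n::finite, 'k::finite, 'd::finite) dg_setup"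
  assumes valid: "valid_setup S"
begin

lemma mesh: "valid_mesh S"
  using valid by (simp add: valid_setup_def)

lemma finite_elems: "finite (elems S)" and finite_faces: "finite (faces S)"
  using mesh by (auto simp: valid_mesh_def)

lemma open_region: "open (region S)"
  using mesh by (simp add: valid_mesh_def)

lemma closure_region: "closure (region S) = (\<Union>\<kappa>\<in>elems S. elem S \<kappa>)"
  using mesh by (simp add: valid_mesh_def)

lemma frontier_region: "frontier (region S) = \<Union> (face_set S ` {f\<in>faces S. nbr f = None})"
  using mesh by (simp add: valid_mesh_def)

lemma valid_face: "f \<in> faces S \<Longrightarrow> valid_face S f"
  using mesh by (simp add: valid_mesh_def)

lemma refel:
  assumes "\<kappa> \<in> elems S"
  shows polytope_refel: "polytope (refel S \<kappa>)" and interior_refel: "interior (refel S \<kappa>) \<noteq> {}"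
    and embedding_refel: "C1_embedding_near (refel S \<kappa>) (emap S \<kappa>)"
  using mesh assms by (auto simp: valid_mesh_def)

lemma compact_refel: "\<kappa> \<in> elems S \<Longrightarrow> compact (refel S \<kappa>)"
  by (simp add: polytope_refel polytope_imp_compact)

lemma convex_refel: "\<kappa> \<in> elems S \<Longrightarrow> convex (refel S \<kappa>)"
  by (simp add: polytope_refel polytope_imp_convex)

lemma closure_interior_refel: "\<kappa> \<in> elems S \<Longrightarrow> closure (interior (refel S \<kappa>)) = refel S \<kappa>"
  using convex_closure_interior[OF convex_refel interior_refel] compact_refel
  by (simp add: compact_imp_closed)

lemma frontier_refel_subset: "\<kappa> \<in> elems S \<Longrightarrow> frontier (refel S \<kappa>) \<subseteq> refel S \<kappa>"
  by (simp add: compact_refel compact_imp_closed frontier_subset_closed)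

lemma emap_refel:
  assumes "\<kappa> \<in> elems S"
  shows emap_differentiable: "emap S \<kappa> differentiable_on refel S \<kappa>"
    and emap_inj: "inj_on (emap S \<kappa>) (refel S \<kappa>)"
    and continuous_on_jac: "continuous_on (refel S \<kappa>) (jac (emap S \<kappa>))"
    and det_jac: "\<And>y. y \<in> refel S \<kappa> \<Longrightarrow> det (jac (emap S \<kappa>) y) \<noteq> 0"
proof -
  obtain V where "refel S \<kappa> \<subseteq> V" "inj_on (emap S \<kappa>) V" "emap S \<kappa> differentiable_on V"
    "continuous_on V (jac (emap S \<kappa>))" "\<And>y. y \<in> V \<Longrightarrow> det (jac (emap S \<kappa>) y) \<noteq> 0"
    using embedding_refel[OF assms] unfolding C1_embedding_near_def by blast
  then show "emap S \<kappa> differentiable_on refel S \<kappa>" "inj_on (emap S \<kappa>) (refel S \<kappa>)"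
    "continuous_on (refel S \<kappa>) (jac (emap S \<kappa>))"
    "\<And>y. y \<in> refel S \<kappa> \<Longrightarrow> det (jac (emap S \<kappa>) y) \<noteq> 0"
    by (auto intro: differentiable_on_subset inj_on_subset continuous_on_subset)
qed

lemma emap_continuous: "\<kappa> \<in> elems S \<Longrightarrow> continuous_on (refel S \<kappa>) (emap S \<kappa>)"
  by (simp add: emap_differentiable differentiable_imp_continuous_on)

lemma open_open_elem:
  assumes "\<kappa> \<in> elems S"
  shows "open (open_elem S \<kappa>)"
  unfolding open_elem_def
  by (intro invariance_of_domain continuous_on_subset[OF emap_continuous[OF assms]]
      inj_on_subset[OF emap_inj[OF assms]] open_interior interior_subset)

lemma open_elem_subset: "open_elem S \<kappa> \<subseteq> elem S \<kappa>"
  unfolding open_elem_def elem_def using interior_subset by blast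

lemma compact_elem: "\<kappa> \<in> elems S \<Longrightarrow> compact (elem S \<kappa>)"
  unfolding elem_def by (intro compact_continuous_image emap_continuous compact_refel)

lemma closed_elem: "\<kappa> \<in> elems S \<Longrightarrow> closed (elem S \<kappa>)"
  by (simp add: compact_elem compact_imp_closed)

lemma closure_open_elem:
  assumes "\<kappa> \<in> elems S"
  shows "closure (open_elem S \<kappa>) = elem S \<kappa>"
proof
  show "closure (open_elem S \<kappa>) \<subseteq> elem S \<kappa>"
    by (intro closure_minimal open_elem_subset closed_elem assms)
  have "emap S \<kappa> ` closure (interior (refel S \<kappa>)) \<subseteq> closure (open_elem S \<kappa>)"
    by (rule image_closure_subset)
      (auto simp: closure_interior_refel emap_continuous assms open_elem_def closure_subset[THEN subsetD])
  then show "elem S \<kappa> \<subseteq> closure (open_elem S \<kappa>)"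
    by (simp add: closure_interior_refel assms elem_def)
qed

text \<open>An open set that is disjoint from the other open element is disjoint from its closure,
  the other closed element.\<close>

lemma open_elem_Int_elem:
  assumes "\<kappa> \<in> elems S" "\<kappa>' \<in> elems S" "\<kappa> \<noteq> \<kappa>'"
  shows "open_elem S \<kappa> \<inter> elem S \<kappa>' = {}"
proof -
  have "disjoint_family_on (open_elem S) (elems S)"
    using mesh by (simp add: valid_mesh_def)
  then have "open_elem S \<kappa> \<inter> open_elem S \<kappa>' = {}"
    using assms by (auto simp: disjoint_family_on_def)
  then show ?thesis
    using open_Int_closure_eq_empty[OF open_open_elem[OF assms(1)], of "open_elem S \<kappa>'"]
    by (simp add: closure_open_elem assms)
qed

lemma open_elem_Int_boundary:
  assumes "\<kappa> \<in> elems S" "\<kappa>' \<in> elems S"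
  shows "open_elem S \<kappa> \<inter> emap S \<kappa>' ` frontier (refel S \<kappa>') = {}"
proof (cases "\<kappa> = \<kappa>'")
  case True
  have "emap S \<kappa> y \<noteq> emap S \<kappa> z" if "y \<in> interior (refel S \<kappa>)" "z \<in> frontier (refel S \<kappa>)" for y z
    using that frontier_refel_subset[OF assms(1)] interior_subset[of "refel S \<kappa>"]
      inj_on_eq_iff[OF emap_inj[OF assms(1)], of y z] by (auto simp: frontier_def)
  then show ?thesis using True by (auto simp: open_elem_def)
next
  case False
  have "emap S \<kappa>' ` frontier (refel S \<kappa>') \<subseteq> elem S \<kappa>'"
    unfolding elem_def by (intro image_mono frontier_refel_subset assms)
  then show ?thesis using open_elem_Int_elem[OF assms False] by blast
qed

lemma elem_boundary:
  "\<kappa> \<in> elems S \<Longrightarrow> emap S \<kappa> ` frontier (refel S \<kappa>) =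
     \<Union> (face_set S ` {f\<in>faces S. owner f = \<kappa> \<or> nbr f = Some \<kappa>})"
  using mesh by (simp add: valid_mesh_def)

lemma elem_cases:
  assumes "\<kappa> \<in> elems S" "x \<in> elem S \<kappa>"
  obtains "x \<in> open_elem S \<kappa>" | "x \<in> emap S \<kappa> ` frontier (refel S \<kappa>)"
proof -
  have "refel S \<kappa> = interior (refel S \<kappa>) \<union> frontier (refel S \<kappa>)"
    using compact_imp_closed[OF compact_refel[OF assms(1)]] closure_Un_frontier[of "refel S \<kappa>"]
      interior_subset[of "refel S \<kappa>"] by (auto simp: frontier_def closure_closed)
  then show thesis using assms that unfolding elem_def open_elem_def by blast
qed

lemma owner_elem: "f \<in> faces S \<Longrightarrow> owner f \<in> elems S"
  using valid_face[of f] by (simp add: valid_face_def)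

lemma nbr_elem:
  assumes "f \<in> faces S" "nbr f = Some \<kappa>'"
  shows "\<kappa>' \<in> elems S" "face_set S f \<subseteq> elem S \<kappa>'"
  using valid_face[OF assms(1)] assms(2) by (auto simp: valid_face_def)

lemma patch_facet:
  assumes "f \<in> faces S"
  obtains G where "G facet_of refel S (owner f)" "patch f \<subseteq> G"
  using valid_face[OF assms] by (auto simp: valid_face_def)

lemma patch_subset_frontier:
  assumes "f \<in> faces S"
  shows "patch f \<subseteq> frontier (refel S (owner f))"
proof -
  obtain G where G: "G facet_of refel S (owner f)" "patch f \<subseteq> G"
    by (rule patch_facet[OF assms])
  have "G face_of refel S (owner f)" "G \<noteq> refel S (owner f)"
    using G(1) by (auto simp: facet_of_def)
  then have "G \<subseteq> rel_frontier (refel S (owner f))"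
    by (rule face_of_subset_rel_frontier)
  moreover have "rel_frontier (refel S (owner f)) = frontier (refel S (owner f))"
    by (rule rel_frontier_nonempty_interior[OF interior_refel[OF owner_elem[OF assms]]])
  ultimately show ?thesis using G(2) by simp
qed

lemma patch_subset: "f \<in> faces S \<Longrightarrow> patch f \<subseteq> refel S (owner f)"
  using patch_subset_frontier frontier_refel_subset owner_elem by blast

lemma face_subset_owner: "f \<in> faces S \<Longrightarrow> face_set S f \<subseteq> elem S (owner f)"
  using patch_subset by (auto simp: face_set_def elem_def)

lemma open_elem_Int_face:
  assumes "\<kappa> \<in> elems S" "f \<in> faces S"
  shows "open_elem S \<kappa> \<inter> face_set S f = {}"
proof -
  have "face_set S f \<subseteq> emap S (owner f) ` frontier (refel S (owner f))"
    unfolding face_set_def by (intro image_mono patch_subset_frontier assms)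
  then show ?thesis
    using open_elem_Int_boundary[OF assms(1) owner_elem[OF assms(2)]] by blast
qed

text \<open>Elements lie in the closure of the region, its frontier consists of boundary faces, and
  an open element meets no face.\<close>

lemma open_elem_subset_region:
  assumes "\<kappa> \<in> elems S"
  shows "open_elem S \<kappa> \<subseteq> region S"
proof
  fix x assume x: "x \<in> open_elem S \<kappa>"
  then have "x \<in> closure (region S)"
    using open_elem_subset assms by (auto simp: closure_region)
  moreover have "x \<notin> frontier (region S)"
    using x open_elem_Int_face[OF assms] by (auto simp: frontier_region)
  ultimately show "x \<in> region S"
    using open_region by (auto simp: frontier_def interior_open)
qed

text \<open>The filter in \<open>trace_on\<close> is thus nontrivial, and the limit taken there is
  unique.\<close>

lemma islimpt_open_elem:
  assumes "\<kappa> \<in> elems S" "x \<in> elem S \<kappa>"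
  shows "x islimpt open_elem S \<kappa>"
proof (cases "x \<in> open_elem S \<kappa>")
  case True
  then show ?thesis
    using open_open_elem[OF assms(1)] by (intro interior_limit_point) (simp add: interior_open)
next
  case False
  then show ?thesis
    using assms closure_open_elem[OF assms(1)] by (auto simp: closure_def)
qed

lemma trace_onI:
  assumes "\<kappa> \<in> elems S" "x \<in> elem S \<kappa>" "(u \<longlongrightarrow> l) (at x within open_elem S \<kappa>)"
  shows "trace_on S \<kappa> u x = l"
  unfolding trace_on_def
  using islimpt_open_elem[OF assms(1,2)]
  by (intro tendsto_Lim assms) (simp add: trivial_limit_within)

lemma trace_on_continuous:
  assumes "\<kappa> \<in> elems S" "x \<in> elem S \<kappa>" "continuous_on (elem S \<kappa>) h"
    and "\<And>x. x \<in> open_elem S \<kappa> \<Longrightarrow> u x = h x"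
  shows "trace_on S \<kappa> u x = h x"
proof (rule trace_onI[OF assms(1,2)])
  have "(h \<longlongrightarrow> h x) (at x within elem S \<kappa>)"
    using assms(2,3) by (simp add: continuous_on_def)
  then have "(h \<longlongrightarrow> h x) (at x within open_elem S \<kappa>)"
    by (rule tendsto_within_subset[OF _ open_elem_subset])
  then show "(u \<longlongrightarrow> h x) (at x within open_elem S \<kappa>)"
    by (rule Lim_transform_eventually) (simp add: eventually_at_filter assms(4))
qed

text \<open>The trace is the polynomial of the element composed with the inverse of the element map,
  and both factors are Lipschitz up to the boundary.\<close>

lemma trace_on_lipschitz:
  assumes "\<kappa> \<in> elems S" "piecewise_poly S u"
  shows "\<exists>L. L-lipschitz_on (elem S \<kappa>) (trace_on S \<kappa> u)"
    and "\<And>x. x \<in> open_elem S \<kappa> \<Longrightarrow> trace_on S \<kappa> u x = u x"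
proof -
  obtain p where p: "poly_fun (degr S) p" "\<And>y. y \<in> interior (refel S \<kappa>) \<Longrightarrow> u (emap S \<kappa> y) = p y"
    using assms by (auto simp: piecewise_poly_def)
  define h where "h = p \<circ> inv_into (refel S \<kappa>) (emap S \<kappa>)"
  obtain M where M: "M-lipschitz_on (refel S \<kappa>) p"
    using lip_bdd_on_poly_fun[OF p(1) compact_imp_bounded[OF compact_refel[OF assms(1)]]]
    by (auto simp: lip_bdd_on_def)
  obtain L where L: "L-lipschitz_on (elem S \<kappa>) (inv_into (refel S \<kappa>) (emap S \<kappa>))"
    using C1_embedding_near_inverse_lipschitz[OF embedding_refel compact_refel] assms(1)
    by (auto simp: elem_def)
  have "inv_into (refel S \<kappa>) (emap S \<kappa>) ` elem S \<kappa> \<subseteq> refel S \<kappa>"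
    by (auto simp: elem_def inv_into_into)
  then have h: "(M * L)-lipschitz_on (elem S \<kappa>) h"
    unfolding h_def by (intro lipschitz_on_compose L lipschitz_on_subset[OF M])
  have u: "u x = h x" if "x \<in> open_elem S \<kappa>" for x
    using that p(2) interior_subset[of "refel S \<kappa>"] emap_inj[OF assms(1)]
    by (auto simp: open_elem_def h_def inv_into_f_f subset_iff)
  have tr: "trace_on S \<kappa> u x = h x" if "x \<in> elem S \<kappa>" for x
    by (rule trace_on_continuous[OF assms(1) that lipschitz_on_continuous_on[OF h] u])
  then show "\<exists>L. L-lipschitz_on (elem S \<kappa>) (trace_on S \<kappa> u)"
    using h by (metis lipschitz_on_transform)
  show "trace_on S \<kappa> u x = u x" if "x \<in> open_elem S \<kappa>" for x
    using tr u that open_elem_subset by auto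
qed

lemma continuous_on_trace:
  assumes "\<kappa> \<in> elems S" "piecewise_poly S u"
  shows "continuous_on (elem S \<kappa>) (trace_on S \<kappa> u)"
  using trace_on_lipschitz(1)[OF assms] lipschitz_on_continuous_on by blast

lemma piecewise_poly_basis: "piecewise_poly S (basis S i)"
  using valid by (auto simp: valid_setup_def valid_basis_def dg_space_def piecewise_poly_def)

lemma piecewise_poly_fun_of: "piecewise_poly S (fun_of S c)"
  unfolding piecewise_poly_def
proof
  fix \<kappa> assume "\<kappa> \<in> elems S"
  then have "\<forall>i. \<exists>p. poly_fun (degr S) p \<and> (\<forall>y\<in>interior (refel S \<kappa>). basis S i (emap S \<kappa> y) = p y)"
    using piecewise_poly_basis by (simp add: piecewise_poly_def)
  then obtain p where "\<And>i. poly_fun (degr S) (p i)"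
    "\<And>i y. y \<in> interior (refel S \<kappa>) \<Longrightarrow> basis S i (emap S \<kappa> y) = p i y"
    by metis
  then show "\<exists>p. poly_fun (degr S) p \<and> (\<forall>y\<in>interior (refel S \<kappa>). fun_of S c (emap S \<kappa> y) = p y)"
    by (intro exI[of _ "\<lambda>y. \<Sum>i\<in>UNIV. c $ i * p i y"])
      (auto simp: fun_of_def intro!: poly_fun_sum poly_fun_mult)
qed

text \<open>\<open>Lim\<close> respects sums only where the limits exist. Here the traces of the
  basis functions are continuous on the closed element, so their combination is the limit.\<close>

lemma trace_on_fun_of:
  assumes "\<kappa> \<in> elems S" "x \<in> elem S \<kappa>"
  shows "trace_on S \<kappa> (fun_of S c) x = (\<Sum>i\<in>UNIV. c $ i * trace_on S \<kappa> (basis S i) x)"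
  by (rule trace_on_continuous[OF assms])
    (auto intro!: continuous_intros continuous_on_trace assms piecewise_poly_basis
      simp: fun_of_def trace_on_lipschitz(2)[OF assms(1) piecewise_poly_basis])

lemma jump_fun_of:
  assumes "f \<in> faces S" "x \<in> face_set S f"
  shows "jump S f (fun_of S c) x = (\<Sum>i\<in>UNIV. c $ i * jump S f (basis S i) x)"
  using assms face_subset_owner[OF assms(1)] nbr_elem[OF assms(1)] owner_elem[OF assms(1)]
  by (cases "nbr f") (auto simp: jump_def trace_on_fun_of right_diff_distrib sum_subtractf subset_iff)

lemma continuous_on_jump:
  assumes "f \<in> faces S" "piecewise_poly S u"
  shows "continuous_on (face_set S f) (jump S f u)"
proof (cases "nbr f")
  case None
  then show ?thesis
    unfolding jump_def
    by (auto intro!: continuous_on_subset[OF continuous_on_trace[OF owner_elem[OF assms(1)] assms(2)]]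
        face_subset_owner assms)
next
  case (Some \<kappa>')
  then show ?thesis
    unfolding jump_def using nbr_elem[OF assms(1) Some] owner_elem[OF assms(1)] face_subset_owner[OF assms(1)]
    by (auto intro!: continuous_on_diff continuous_on_subset[OF continuous_on_trace] assms)
qed

lemma continuous_on_avg:
  assumes "f \<in> faces S" "piecewise_poly S u"
  shows "continuous_on (face_set S f) (avg S f u)"
proof (cases "nbr f")
  case None
  then show ?thesis
    unfolding avg_def
    by (auto intro!: continuous_on_subset[OF continuous_on_trace[OF owner_elem[OF assms(1)] assms(2)]]
        face_subset_owner assms)
next
  case (Some \<kappa>')
  then show ?thesis
    unfolding avg_def using nbr_elem[OF assms(1) Some] owner_elem[OF assms(1)] face_subset_owner[OF assms(1)]
    by (auto intro!: continuous_on_divide continuous_on_add continuous_on_subset[OF continuous_on_trace] assms)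
qed

section \<open>The face matrix\<close>

text \<open>The supporting hyperplane that cuts out the facet supplies, after normalization, a
  witness for the choice in \<open>flat_normal\<close>.\<close>

lemma flat_normal:
  assumes "f \<in> faces S"
  shows norm_flat_normal: "norm (flat_normal (refel S (owner f)) (patch f)) = 1"
    and flat_normal_le: "\<And>y z. y \<in> patch f \<Longrightarrow> z \<in> refel S (owner f) \<Longrightarrow>
      flat_normal (refel S (owner f)) (patch f) \<bullet> z \<le> flat_normal (refel S (owner f)) (patch f) \<bullet> y"
proof -
  let ?K = "refel S (owner f)" and ?P = "\<lambda>\<nu>. norm \<nu> = 1 \<and> (\<forall>y\<in>patch f. \<forall>z\<in>refel S (owner f). \<nu> \<bullet> z \<le> \<nu> \<bullet> y)"
  obtain G where G: "G facet_of ?K" "patch f \<subseteq> G"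
    by (rule patch_facet[OF assms])
  obtain a b where ab: "a \<noteq> 0" "?K \<subseteq> {x. a \<bullet> x \<le> b}" "G = ?K \<inter> {x. a \<bullet> x = b}"
    by (rule facet_of_polyhedron[OF polytope_imp_polyhedron[OF polytope_refel[OF owner_elem[OF assms]]] G(1)])
  have "?P (a /\<^sub>R norm a)"
  proof (intro conjI ballI)
    fix y z assume "y \<in> patch f" "z \<in> ?K"
    with ab(2,3) G(2) have "a \<bullet> z \<le> a \<bullet> y" by auto
    then show "(a /\<^sub>R norm a) \<bullet> z \<le> (a /\<^sub>R norm a) \<bullet> y"
      by (simp add: mult_left_mono)
  qed (use ab(1) in simp)
  then have "?P (flat_normal ?K (patch f))"
    unfolding flat_normal_def by (rule someI)
  then show "norm (flat_normal ?K (patch f)) = 1"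
    "\<And>y z. y \<in> patch f \<Longrightarrow> z \<in> ?K \<Longrightarrow> flat_normal ?K (patch f) \<bullet> z \<le> flat_normal ?K (patch f) \<bullet> y"
    by auto
qed

text \<open>Every point of the patch maximizes the normal functional over the reference element, so
  the functional takes one value on the patch.\<close>

lemma flat_patch_face:
  assumes "f \<in> faces S"
  shows "\<exists>c. flat_patch (patch f) (flat_normal (refel S (owner f)) (patch f)) c"
proof -
  let ?\<nu> = "flat_normal (refel S (owner f)) (patch f)"
  have p: "polytope (patch f)" "aff_dim (patch f) = int CARD('n) - 1"
    using valid_face[OF assms] by (auto simp: valid_face_def)
  then have "patch f \<noteq> {}" by (auto simp: aff_dim_empty)
  then obtain y0 where y0: "y0 \<in> patch f" by auto
  have "?\<nu> \<bullet> y = ?\<nu> \<bullet> y0" if "y \<in> patch f" for y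
  proof (rule antisym)
    show "?\<nu> \<bullet> y \<le> ?\<nu> \<bullet> y0"
      using that patch_subset[OF assms] by (intro flat_normal_le[OF assms y0]) auto
    show "?\<nu> \<bullet> y0 \<le> ?\<nu> \<bullet> y"
      using y0 patch_subset[OF assms] by (intro flat_normal_le[OF assms that]) auto
  qed
  then have "flat_patch (patch f) ?\<nu> (?\<nu> \<bullet> y0)"
    using polytope_imp_compact[OF p(1)] polytope_imp_convex[OF p(1)] \<open>patch f \<noteq> {}\<close> p(2)
      norm_flat_normal[OF assms]
    by (intro flat_patch.intro)
  then show ?thesis ..
qed

section \<open>Surface elements and linearity of face integrals\<close>

definition density :: "('e, 'n) face \<Rightarrow> real^'n \<Rightarrow> real" where
  "density f y = \<bar>det (jac (emap S (owner f)) y)\<bar> * norm (conormal S f y)"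

definition alpha :: "real^'n \<Rightarrow> real" where
  "alpha n = 1 / (4 * pi) * (\<Sum>d\<in>UNIV. wt S d * \<bar>sdir S d \<bullet> n\<bar>)"

lemma face_integral_eq:
  "face_integral S f h = flat_integral (patch f) (flat_normal (refel S (owner f)) (patch f))
     (\<lambda>y. h (emap S (owner f) y) (face_normal S f y) * density f y)"
  by (simp add: face_integral_def density_def)

text \<open>The transposed Jacobian takes the conormal back to the unit normal of the reference
  facet.\<close>

lemma conormal_nonzero:
  assumes "f \<in> faces S" "y \<in> patch f"
  shows "conormal S f y \<noteq> 0"
proof
  assume "conormal S f y = 0"
  let ?J = "jac (emap S (owner f)) y" and ?\<nu> = "flat_normal (refel S (owner f)) (patch f)"
  have "invertible ?J"
    using det_jac[OF owner_elem[OF assms(1)]] patch_subset[OF assms(1)] assms(2)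
    by (auto simp: invertible_det_nz)
  then have "?\<nu> = transpose (matrix_inv ?J ** ?J) *v ?\<nu>"
    by (simp add: matrix_inv_left transpose_mat)
  also have "\<dots> = transpose ?J *v conormal S f y"
    by (simp only: matrix_transpose_mul conormal_def matrix_vector_mul_assoc)
  finally show False
    using norm_flat_normal[OF assms(1)] \<open>conormal S f y = 0\<close> by simp
qed

lemma density_pos:
  assumes "f \<in> faces S" "y \<in> patch f"
  shows "density f y > 0"
  using conormal_nonzero[OF assms] det_jac[OF owner_elem[OF assms(1)]] patch_subset[OF assms(1)] assms(2)
  by (auto simp: density_def)

lemma continuous_on_jac_patch:
  "f \<in> faces S \<Longrightarrow> continuous_on (patch f) (jac (emap S (owner f)))"
  by (rule continuous_on_subset[OF continuous_on_jac[OF owner_elem] patch_subset])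

lemma continuous_on_conormal:
  assumes "f \<in> faces S"
  shows "continuous_on (patch f) (conormal S f)"
proof -
  have "continuous_on (patch f) (\<lambda>y. matrix_inv (jac (emap S (owner f)) y))"
    using det_jac[OF owner_elem[OF assms]] patch_subset[OF assms]
    by (intro continuous_on_matrix_inv continuous_on_jac_patch assms) auto
  then show ?thesis
    unfolding conormal_def[abs_def] matrix_vector_mult_def transpose_def
    by (auto intro!: continuous_intros)
qed

lemma continuous_on_face_normal:
  assumes "f \<in> faces S"
  shows "continuous_on (patch f) (face_normal S f)"
  unfolding face_normal_def[abs_def]
  by (intro continuous_intros continuous_on_conormal assms) (simp add: conormal_nonzero assms)

lemma continuous_on_density:
  assumes "f \<in> faces S"
  shows "continuous_on (patch f) (density f)"
  unfolding density_def[abs_def]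
  by (intro continuous_intros continuous_on_det continuous_on_conormal continuous_on_jac_patch assms)

lemma continuous_on_emap_patch:
  assumes "f \<in> faces S" "continuous_on (face_set S f) a"
  shows "continuous_on (patch f) (\<lambda>y. a (emap S (owner f) y))"
  by (rule continuous_on_compose2[OF assms(2)])
    (auto simp: face_set_def intro!: continuous_on_subset[OF emap_continuous] owner_elem
      patch_subset assms)

lemma continuous_on_normal_patch:
  assumes "f \<in> faces S" "continuous_on UNIV b"
  shows "continuous_on (patch f) (\<lambda>y. b (face_normal S f y))"
  by (rule continuous_on_compose2[OF assms(2) continuous_on_face_normal[OF assms(1)]]) simp

lemma face_integral_cong:
  assumes "f \<in> faces S" "\<And>x n. x \<in> face_set S f \<Longrightarrow> h x n = h' x n"
  shows "face_integral S f h = face_integral S f h'"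
proof -
  obtain c where "flat_patch (patch f) (flat_normal (refel S (owner f)) (patch f)) c"
    using flat_patch_face[OF assms(1)] by blast
  then interpret flat_patch "patch f" "flat_normal (refel S (owner f)) (patch f)" c .
  show ?thesis
    unfolding face_integral_eq by (rule flat_integral_cong) (simp add: assms face_set_def)
qed

lemma face_integral_sum:
  assumes "f \<in> faces S"
    and "\<And>i. i \<in> I \<Longrightarrow> continuous_on (patch f) (\<lambda>y. h i (emap S (owner f) y) (face_normal S f y))"
  shows "face_integral S f (\<lambda>x n. \<Sum>i\<in>I. a i * h i x n) = (\<Sum>i\<in>I. a i * face_integral S f (h i))"
proof -
  obtain c where "flat_patch (patch f) (flat_normal (refel S (owner f)) (patch f)) c"
    using flat_patch_face[OF assms(1)] by blast
  then interpret flat_patch "patch f" "flat_normal (refel S (owner f)) (patch f)" c .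
  have "face_integral S f (\<lambda>x n. \<Sum>i\<in>I. a i * h i x n) =
     flat_integral (patch f) (flat_normal (refel S (owner f)) (patch f))
     (\<lambda>y. \<Sum>i\<in>I. a i * (h i (emap S (owner f) y) (face_normal S f y) * density f y))"
    by (simp add: face_integral_eq sum_distrib_right mult.assoc)
  also have "\<dots> = (\<Sum>i\<in>I. a i * face_integral S f (h i))"
    by (subst flat_integral_sum)
      (auto intro!: continuous_on_mult assms continuous_on_density
        simp: flat_integral_mult face_integral_eq)
  finally show ?thesis .
qed

section \<open>Angular averages and the kernel of the averaged face matrix\<close>

lemma sum_wt_sdir: "(\<Sum>d\<in>UNIV. wt S d * (sdir S d \<bullet> n)) = 0"
proof -
  have "(\<Sum>d\<in>UNIV. wt S d *\<^sub>R dir S d) = 0"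
    using valid by (simp add: valid_setup_def valid_quadrature_def)
  then have 0: "(\<Sum>d\<in>UNIV. wt S d * dir S d $ j) = 0" for j
  proof -
    have "(\<Sum>d\<in>UNIV. wt S d *\<^sub>R dir S d) $ j = 0" using \<open>_ = 0\<close> by simp
    then show ?thesis by simp
  qed
  have "(\<Sum>d\<in>UNIV. wt S d * (sdir S d \<bullet> n)) = (\<Sum>d\<in>UNIV. \<Sum>m\<in>UNIV. (wt S d * dir S d $ coord S m) * n $ m)"
    by (simp add: inner_vec_def sdir_def sum_distrib_left mult.assoc)
  also have "\<dots> = (\<Sum>m\<in>UNIV. (\<Sum>d\<in>UNIV. wt S d * dir S d $ coord S m) * n $ m)"
    by (subst sum.swap) (simp add: sum_distrib_right)
  finally show ?thesis by (simp add: 0)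
qed

text \<open>The term with \<open>sdir S d \<bullet> n\<close> is the only one that treats trial and
  test function differently. It is linear in the direction, so the vanishing first moment of the
  quadrature removes it, and the penalty on the jumps remains with weight
  \<open>alpha\<close>.\<close>

lemma F0_entry:
  "F0 S $ i $ j = 1/2 * (\<Sum>f\<in>faces S. face_integral S f
     (\<lambda>x n. alpha n * (jump S f (basis S j) x * jump S f (basis S i) x)))"
proof -
  let ?a = "\<lambda>f d. face_integral S f (\<lambda>x n. (sdir S d \<bullet> n) * jump S f (basis S j) x * avg S f (basis S i) x)"
  let ?b = "\<lambda>f d. face_integral S f (\<lambda>x n. \<bar>sdir S d \<bullet> n\<bar> * jump S f (basis S j) x * jump S f (basis S i) x)"
  have a: "(\<Sum>d\<in>UNIV. wt S d * ?a f d) = 0" if f: "f \<in> faces S" for f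
  proof -
    have "(\<Sum>d\<in>UNIV. wt S d * ?a f d) =
        face_integral S f (\<lambda>x n. \<Sum>d\<in>UNIV. wt S d *
          ((sdir S d \<bullet> n) * jump S f (basis S j) x * avg S f (basis S i) x))"
      by (rule face_integral_sum[OF f, symmetric])
        (intro continuous_on_mult continuous_on_normal_patch continuous_on_emap_patch f
          continuous_on_jump continuous_on_avg piecewise_poly_basis continuous_intros)
    also have "\<dots> = face_integral S f (\<lambda>x n. (\<Sum>d\<in>UNIV. wt S d * (sdir S d \<bullet> n)) *
          (jump S f (basis S j) x * avg S f (basis S i) x))"
      by (simp add: sum_distrib_right mult.assoc)
    also have "\<dots> = 0"
      \<comment> \<open>The empty sum is the instance stating that the integral of 0 is 0.\<close>
      using face_integral_sum[OF f, of "{}" h a for h a] by (simp add: sum_wt_sdir)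
    finally show ?thesis .
  qed
  have b: "(\<Sum>d\<in>UNIV. wt S d / (4 * pi) * ?b f d) =
      face_integral S f (\<lambda>x n. alpha n * (jump S f (basis S j) x * jump S f (basis S i) x))"
    if f: "f \<in> faces S" for f
  proof -
    have "(\<Sum>d\<in>UNIV. wt S d / (4 * pi) * ?b f d) =
        face_integral S f (\<lambda>x n. \<Sum>d\<in>UNIV. wt S d / (4 * pi) *
          (\<bar>sdir S d \<bullet> n\<bar> * jump S f (basis S j) x * jump S f (basis S i) x))"
      by (rule face_integral_sum[OF f, symmetric])
        (intro continuous_on_mult continuous_on_normal_patch continuous_on_emap_patch f
          continuous_on_jump continuous_on_avg piecewise_poly_basis continuous_intros)
    also have "\<dots> = face_integral S f (\<lambda>x n. alpha n * (jump S f (basis S j) x * jump S f (basis S i) x))"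
      by (simp add: alpha_def sum_distrib_right sum_distrib_left sum_divide_distrib mult.assoc)
    finally show ?thesis .
  qed
  have swap: "(\<Sum>d\<in>UNIV. wt S d * (- (\<Sum>f\<in>faces S. a f d) + 1/2 * (\<Sum>f\<in>faces S. b f d))) =
      - (\<Sum>f\<in>faces S. \<Sum>d\<in>UNIV. wt S d * a f d) + 1/2 * (\<Sum>f\<in>faces S. \<Sum>d\<in>UNIV. wt S d * b f d)"
    for a b :: "('e, 'n) face \<Rightarrow> 'd \<Rightarrow> real"
  proof -
    have "(\<Sum>f\<in>faces S. \<Sum>d\<in>UNIV. wt S d * a f d) = (\<Sum>d\<in>UNIV. wt S d * (\<Sum>f\<in>faces S. a f d))"
      for a :: "('e, 'n) face \<Rightarrow> 'd \<Rightarrow> real"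
      by (subst sum.swap) (simp add: sum_distrib_left)
    then have "- (\<Sum>f\<in>faces S. \<Sum>d\<in>UNIV. wt S d * a f d) + 1/2 * (\<Sum>f\<in>faces S. \<Sum>d\<in>UNIV. wt S d * b f d) =
        (\<Sum>d\<in>UNIV. - (wt S d * (\<Sum>f\<in>faces S. a f d)) + 1/2 * (wt S d * (\<Sum>f\<in>faces S. b f d)))"
      by (simp only: sum.distrib sum_negf sum_distrib_left[symmetric])
    then show ?thesis by (simp add: right_diff_distrib)
  qed
  have "F0 S $ i $ j = 1 / (4 * pi) * (\<Sum>d\<in>UNIV. wt S d *
      (- (\<Sum>f\<in>faces S. ?a f d) + 1/2 * (\<Sum>f\<in>faces S. ?b f d)))"
    by (simp add: F0_def Fmat_def form_matrix_def Fform_def sum_component)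
  also have "\<dots> = 1 / (4 * pi) * (- (\<Sum>f\<in>faces S. \<Sum>d\<in>UNIV. wt S d * ?a f d)
      + 1/2 * (\<Sum>f\<in>faces S. \<Sum>d\<in>UNIV. wt S d * ?b f d))"
    by (simp only: swap)
  also have "\<dots> = 1/2 * (\<Sum>f\<in>faces S. \<Sum>d\<in>UNIV. wt S d / (4 * pi) * ?b f d)"
    by (simp add: a sum_distrib_left)
  also have "\<dots> = 1/2 * (\<Sum>f\<in>faces S. face_integral S f
     (\<lambda>x n. alpha n * (jump S f (basis S j) x * jump S f (basis S i) x)))"
    by (intro arg_cong[where f = "(*) (1/2)"] sum.cong refl b)
  finally show ?thesis .
qed

lemma transpose_F0: "transpose (F0 S) = F0 S"
  by (simp add: vec_eq_iff transpose_def F0_entry mult.commute)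

lemma continuous_on_alpha: "continuous_on UNIV alpha"
  unfolding alpha_def[abs_def] by (intro continuous_intros)

lemma F0_vec:
  "(F0 S *v c) $ i = 1/2 * (\<Sum>f\<in>faces S. face_integral S f
     (\<lambda>x n. alpha n * (jump S f (fun_of S c) x * jump S f (basis S i) x)))"
proof -
  let ?h = "\<lambda>f j x n. alpha n * (jump S f (basis S j) x * jump S f (basis S i) x)"
  have *: "face_integral S f (\<lambda>x n. alpha n * (jump S f (fun_of S c) x * jump S f (basis S i) x)) =
      (\<Sum>j\<in>UNIV. c $ j * face_integral S f (?h f j))" if f: "f \<in> faces S" for f
  proof -
    have "face_integral S f (\<lambda>x n. alpha n * (jump S f (fun_of S c) x * jump S f (basis S i) x)) =
        face_integral S f (\<lambda>x n. \<Sum>j\<in>UNIV. c $ j * ?h f j x n)"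
      by (rule face_integral_cong[OF f])
        (simp add: jump_fun_of[OF f] sum_distrib_left sum_distrib_right algebra_simps)
    also have "\<dots> = (\<Sum>j\<in>UNIV. c $ j * face_integral S f (?h f j))"
      by (rule face_integral_sum[OF f])
        (intro continuous_on_mult continuous_on_normal_patch continuous_on_emap_patch f
          continuous_on_jump piecewise_poly_basis continuous_on_alpha)
    finally show ?thesis .
  qed
  have "(F0 S *v c) $ i = 1/2 * (\<Sum>j\<in>UNIV. \<Sum>f\<in>faces S. c $ j * face_integral S f (?h f j))"
    by (simp add: matrix_vector_mult_def F0_entry sum_distrib_left algebra_simps)
  also have "\<dots> = 1/2 * (\<Sum>f\<in>faces S. \<Sum>j\<in>UNIV. c $ j * face_integral S f (?h f j))"
    by (subst sum.swap) simp
  finally show ?thesis by (simp add: * cong: sum.cong)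
qed

lemma F0_form:
  "c \<bullet> (F0 S *v c) = 1/2 * (\<Sum>f\<in>faces S. face_integral S f
     (\<lambda>x n. alpha n * (jump S f (fun_of S c) x)\<^sup>2))"
proof -
  let ?h = "\<lambda>f i x n. alpha n * (jump S f (fun_of S c) x * jump S f (basis S i) x)"
  have *: "face_integral S f (\<lambda>x n. alpha n * (jump S f (fun_of S c) x)\<^sup>2) =
      (\<Sum>i\<in>UNIV. c $ i * face_integral S f (?h f i))" if f: "f \<in> faces S" for f
  proof -
    have "face_integral S f (\<lambda>x n. alpha n * (jump S f (fun_of S c) x)\<^sup>2) =
        face_integral S f (\<lambda>x n. \<Sum>i\<in>UNIV. c $ i * ?h f i x n)"
    proof (rule face_integral_cong[OF f])
      fix x n assume x: "x \<in> face_set S f"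
      have "(\<Sum>i\<in>UNIV. c $ i * ?h f i x n) =
          alpha n * (jump S f (fun_of S c) x * (\<Sum>i\<in>UNIV. c $ i * jump S f (basis S i) x))"
        by (simp add: sum_distrib_left algebra_simps)
      then show "alpha n * (jump S f (fun_of S c) x)\<^sup>2 = (\<Sum>i\<in>UNIV. c $ i * ?h f i x n)"
        using jump_fun_of[OF f x, of c] by (simp add: power2_eq_square)
    qed
    also have "\<dots> = (\<Sum>i\<in>UNIV. c $ i * face_integral S f (?h f i))"
      by (rule face_integral_sum[OF f])
        (intro continuous_on_mult continuous_on_normal_patch continuous_on_emap_patch f
          continuous_on_jump piecewise_poly_basis piecewise_poly_fun_of continuous_on_alpha)
    finally show ?thesis .
  qed
  have "c \<bullet> (F0 S *v c) = 1/2 * (\<Sum>i\<in>UNIV. \<Sum>f\<in>faces S. c $ i * face_integral S f (?h f i))"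
    by (simp add: inner_vec_def F0_vec sum_distrib_left algebra_simps)
  also have "\<dots> = 1/2 * (\<Sum>f\<in>faces S. \<Sum>i\<in>UNIV. c $ i * face_integral S f (?h f i))"
    by (subst sum.swap) simp
  finally show ?thesis by (simp add: * cong: sum.cong)
qed

lemma F0_kernelI:
  assumes "\<And>f x. f \<in> faces S \<Longrightarrow> x \<in> face_set S f \<Longrightarrow> jump S f (fun_of S c) x = 0"
  shows "F0 S *v c = 0"
proof -
  have "face_integral S f (\<lambda>x n. alpha n * (jump S f (fun_of S c) x * jump S f (basis S i) x)) = 0"
    if "f \<in> faces S" for f i
  proof -
    have "face_integral S f (\<lambda>x n. alpha n * (jump S f (fun_of S c) x * jump S f (basis S i) x)) =
        face_integral S f (\<lambda>x n. 0)"
      by (rule face_integral_cong[OF that]) (simp add: assms that)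
    then show ?thesis
      using face_integral_sum[OF that, of "{}" h a for h a] by simp
  qed
  then show ?thesis by (simp add: vec_eq_iff F0_vec)
qed

lemma alpha_nonneg: "0 \<le> alpha n"
proof -
  have "0 \<le> wt S d" for d
    using valid by (simp add: valid_setup_def valid_quadrature_def less_imp_le)
  then show ?thesis by (simp add: alpha_def sum_nonneg)
qed

text \<open>The quadratic form is a sum of nonnegative integrals, so each of them is 0 and each
  continuous integrand vanishes at every point of its face. The factors \<open>alpha\<close> and
  \<open>density\<close> are positive, which leaves the jump.\<close>

lemma F0_kernelD:
  assumes "alpha_bounded_below S" "F0 S *v c = 0" and f: "f \<in> faces S" and x: "x \<in> face_set S f"
  shows "jump S f (fun_of S c) x = 0"
proof -
  let ?h = "\<lambda>f x n. alpha n * (jump S f (fun_of S c) x)\<^sup>2"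
  have nonneg: "0 \<le> face_integral S f (?h f)" if f: "f \<in> faces S" for f
  proof -
    obtain k where "flat_patch (patch f) (flat_normal (refel S (owner f)) (patch f)) k"
      using flat_patch_face[OF f] by blast
    then interpret flat_patch "patch f" "flat_normal (refel S (owner f)) (patch f)" k .
    show ?thesis
      unfolding face_integral_eq
      by (intro flat_integral_nonneg mult_nonneg_nonneg alpha_nonneg density_pos[THEN less_imp_le] f) auto
  qed
  have "(\<Sum>f\<in>faces S. face_integral S f (?h f)) = 0"
    using F0_form[of c] assms(2) by simp
  then have 0: "face_integral S f (?h f) = 0"
    using nonneg f by (simp add: sum_nonneg_eq_0_iff[OF finite_faces])
  obtain k where "flat_patch (patch f) (flat_normal (refel S (owner f)) (patch f)) k"
    using flat_patch_face[OF f] by blast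
  then interpret flat_patch "patch f" "flat_normal (refel S (owner f)) (patch f)" k .
  obtain y where y: "y \<in> patch f" "x = emap S (owner f) y"
    using x by (auto simp: face_set_def)
  have "?h f (emap S (owner f) y) (face_normal S f y) * density f y = 0"
  proof (rule flat_integral_eq_0D[OF _ _ 0[unfolded face_integral_eq] y(1)])
    show "continuous_on (patch f) (\<lambda>y. ?h f (emap S (owner f) y) (face_normal S f y) * density f y)"
      by (intro continuous_on_mult continuous_on_power continuous_on_normal_patch continuous_on_emap_patch f
          continuous_on_jump piecewise_poly_fun_of continuous_on_alpha continuous_on_density)
    show "0 \<le> ?h f (emap S (owner f) y) (face_normal S f y) * density f y" if "y \<in> patch f" for y
      by (intro mult_nonneg_nonneg alpha_nonneg density_pos[THEN less_imp_le] f that) auto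
  qed
  moreover have "0 < alpha (face_normal S f y)"
    using assms(1) f y(1) unfolding alpha_bounded_below_def alpha_def by (meson less_le_trans)
  ultimately show ?thesis
    using density_pos[OF f y(1)] y(2) by simp
qed

end

section \<open>Functions without jumps\<close>

lemma closure_compl_negligible:
  fixes T :: "'a::euclidean_space set"
  assumes "negligible T"
  shows "closure (- T) = UNIV"
proof -
  have "interior T = {}"
    using assms open_not_negligible[OF open_interior] negligible_subset interior_subset by metis
  then show ?thesis by (simp add: closure_complement)
qed

text \<open>A set of codimension two casts a shadow of codimension one: the shadow is the image of
  a subset of a hyperplane, obtained by adding the distance from the light source as a new
  coordinate along a vector \<open>\<tau>\<close> orthogonal to the set.\<close>

lemma negligible_shadow:
  fixes \<phi> :: "real^'n \<Rightarrow> real^'n"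
  assumes diff: "\<phi> differentiable_on R" and dim: "aff_dim R \<le> int CARD('n) - 2" and a: "a \<notin> \<phi> ` R"
  shows "negligible {b. closed_segment a b \<inter> \<phi> ` R \<noteq> {}}"
proof (cases "R = {}")
  case False
  then obtain y0 where y0: "y0 \<in> R" by auto
  define R0 where "R0 = (+) (- y0) ` R"
  have "aff_dim R = int (dim R0)"
    unfolding R0_def using y0 by (intro aff_dim_eq_dim hull_inc)
  then have dimR0: "dim R0 + 1 < CARD('n)" using dim by linarith
  \<comment> \<open>Codimension two leaves room: a vector can be chosen orthogonal to the directions
    of \<open>R\<close>, and adjoining it still gives a proper subspace. This makes \<open>D\<close>
    below negligible.\<close>
  then obtain \<tau> where \<tau>: "\<tau> \<noteq> 0" "\<And>y. y \<in> span R0 \<Longrightarrow> orthogonal \<tau> y"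
    using orthogonal_to_subspace_exists[of R0] by auto
  have orth: "\<tau> \<bullet> (y - y0) = 0" if "y \<in> R" for y
  proof -
    have "y - y0 \<in> R0" using that by (auto simp: R0_def image_iff intro!: bexI[of _ y])
    then show ?thesis using \<tau>(2)[OF span_base] by (simp add: orthogonal_def)
  qed
  \<comment> \<open>\<open>s\<close> reads off the coordinate along \<open>\<tau>\<close> and
    \<open>\<pi>\<close> removes it. Hence \<open>\<Psi>\<close> sends
    \<open>y + t *\<^sub>R \<tau>\<close> to the point with parameter \<open>t\<close> on the line
    from \<open>a\<close> through \<open>\<phi> y\<close>.\<close>
  define s where "s x = \<tau> \<bullet> (x - y0) / (\<tau> \<bullet> \<tau>)" for x
  define \<pi> where "\<pi> x = x - s x *\<^sub>R \<tau>" for x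
  define D where "D = {y + t *\<^sub>R \<tau> | y t. y \<in> R}"
  define \<Psi> where "\<Psi> x = a + s x *\<^sub>R (\<phi> (\<pi> x) - a)" for x
  have s: "s (y + t *\<^sub>R \<tau>) = t" if "y \<in> R" for y t
  proof -
    have "\<tau> \<bullet> (y + t *\<^sub>R \<tau> - y0) = \<tau> \<bullet> (y - y0) + t * (\<tau> \<bullet> \<tau>)"
      by (simp add: inner_diff_right inner_add_right)
    then show ?thesis using \<tau>(1) orth[OF that] by (simp add: s_def)
  qed
  then have \<pi>: "\<pi> (y + t *\<^sub>R \<tau>) = y" if "y \<in> R" for y t
    using that by (simp add: \<pi>_def)
  have "negligible D"
  proof -
    have "y + t *\<^sub>R \<tau> \<in> (+) y0 ` span (insert \<tau> R0)" if "y \<in> R" for y t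
    proof -
      have "y - y0 \<in> span (insert \<tau> R0)"
        using that by (intro span_base) (auto simp: R0_def image_iff intro!: bexI[of _ y])
      then have "(y - y0) + t *\<^sub>R \<tau> \<in> span (insert \<tau> R0)"
        by (intro span_add span_scale) (auto intro: span_base)
      then show ?thesis
        by (intro image_eqI[of _ _ "(y - y0) + t *\<^sub>R \<tau>"]) auto
    qed
    then have "D \<subseteq> (+) y0 ` span (insert \<tau> R0)" by (auto simp: D_def)
    moreover have "dim (insert \<tau> R0) < DIM(real^'n)"
      using dimR0 dim_insert[of \<tau> R0] by (simp split: if_splits)
    then have "negligible ((+) y0 ` span (insert \<tau> R0))"
      by (intro negligible_translation negligible_lowdim) simp
    ultimately show ?thesis using negligible_subset by blast
  qed
  moreover have "\<Psi> differentiable_on D"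
  proof -
    have sd: "s differentiable_on D"
      unfolding differentiable_on_def
    proof
      fix x
      have "(s has_derivative (\<lambda>h. \<tau> \<bullet> h / (\<tau> \<bullet> \<tau>))) (at x within D)"
        unfolding s_def using \<tau>(1) by (auto intro!: derivative_eq_intros)
      then show "s differentiable at x within D" by (rule differentiableI)
    qed
    have \<pi>d: "\<pi> differentiable_on D"
      unfolding \<pi>_def by (intro differentiable_on_diff differentiable_on_ident
          differentiable_on_scaleR sd differentiable_on_const)
    have "(\<lambda>x. \<phi> (\<pi> x)) differentiable_on D"
      by (rule differentiable_on_compose[OF \<pi>d differentiable_on_subset[OF diff]])
        (auto simp: D_def \<pi>)
    then show ?thesis
      unfolding \<Psi>_def by (intro differentiable_on_add differentiable_on_diff
          differentiable_on_scaleR sd differentiable_on_const)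
  qed
  ultimately have "negligible (\<Psi> ` D)"
    by (intro negligible_differentiable_image_negligible) auto
  moreover have "{b. closed_segment a b \<inter> \<phi> ` R \<noteq> {}} \<subseteq> \<Psi> ` D"
  proof
    fix b assume "b \<in> {b. closed_segment a b \<inter> \<phi> ` R \<noteq> {}}"
    then obtain y u where yu: "y \<in> R" "\<phi> y = (1 - u) *\<^sub>R a + u *\<^sub>R b" "0 \<le> u" "u \<le> 1"
      by (auto simp: closed_segment_def)
    have "u \<noteq> 0" using yu a by auto
    have "\<phi> y - a = u *\<^sub>R (b - a)" using yu(2) by (simp add: algebra_simps)
    \<comment> \<open>A point of the segment at parameter \<open>u\<close> is reached from
      \<open>b\<close> by shrinking towards \<open>a\<close>; undoing this needs the factor
      \<open>1/u\<close>. It exists because \<open>u = 0\<close> would put \<open>a\<close> itself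
      into the image of \<open>R\<close>.\<close>
    then have "b = \<Psi> (y + (1/u) *\<^sub>R \<tau>)"
      using yu(1) \<open>u \<noteq> 0\<close> by (simp add: \<Psi>_def s \<pi>)
    then show "b \<in> \<Psi> ` D" using yu(1) by (auto simp: D_def)
  qed
  ultimately show ?thesis by (rule negligible_subset)
qed simp

context dg
begin

lemma AE_region:
  "(AE x in lebesgue_on (region S). P x) \<longleftrightarrow> (AE x\<in>region S in lebesgue. P x)"
  by (rule AE_restrict_space_iff) (simp add: open_region lmeasurable_open borel_open)

text \<open>On an open element two continuous functions that agree almost everywhere agree
  everywhere, so every trace equals the continuous representative \<open>g\<close>. The two sides of
  an interior face then cancel, and on a boundary face \<open>g\<close> is 0.\<close>

lemma jump_continuous_coeffs:
  assumes "c \<in> continuous_coeffs S" and f: "f \<in> faces S" and x: "x \<in> face_set S f"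
  shows "jump S f (fun_of S c) x = 0"
proof -
  obtain g where g: "continuous_on (closure (region S)) g" "\<And>x. x \<in> frontier (region S) \<Longrightarrow> g x = 0"
    and ae: "AE x in lebesgue_on (region S). fun_of S c x = g x"
    using assms(1) by (auto simp: continuous_coeffs_def)
  have tr: "trace_on S \<kappa> (fun_of S c) x = g x" if \<kappa>: "\<kappa> \<in> elems S" and x: "x \<in> elem S \<kappa>" for \<kappa> x
  proof -
    let ?t = "trace_on S \<kappa> (fun_of S c)"
    have gc: "continuous_on (elem S \<kappa>) g"
      using \<kappa> by (intro continuous_on_subset[OF g(1)]) (auto simp: closure_region)
    let ?C = "{x \<in> elem S \<kappa>. ?t x = g x}"
    have "closed ((\<lambda>x. ?t x - g x) -` {0} \<inter> elem S \<kappa>)"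
      by (intro continuous_on_closed_vimage[THEN iffD1, rule_format] closed_elem \<kappa>
          continuous_on_diff continuous_on_trace piecewise_poly_fun_of gc) auto
    then have cl: "closed ?C" by (simp add: vimage_def Int_def conj_commute)
    have "AE x \<in> open_elem S \<kappa> in lebesgue. x \<in> ?C"
      using ae unfolding AE_region
      by (rule eventually_mono)
        (use open_elem_subset_region[OF \<kappa>] open_elem_subset[of \<kappa>]
          trace_on_lipschitz(2)[OF \<kappa> piecewise_poly_fun_of] in auto)
    then have "fun_of S c x = g x" if "x \<in> open_elem S \<kappa>" for x
      using mem_closed_if_AE_lebesgue_open[OF open_open_elem[OF \<kappa>] cl _ that]
        trace_on_lipschitz(2)[OF \<kappa> piecewise_poly_fun_of that] by auto
    then show ?thesis
      by (rule trace_on_continuous[OF \<kappa> x gc])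
  qed
  have own: "x \<in> elem S (owner f)" using face_subset_owner[OF f] x by auto
  show ?thesis
  proof (cases "nbr f")
    case None
    then have "x \<in> frontier (region S)" using x f by (auto simp: frontier_region)
    then show ?thesis using None tr[OF owner_elem[OF f] own] g(2) by (simp add: jump_def)
  next
    case (Some \<kappa>')
    then show ?thesis
      using tr[OF owner_elem[OF f] own] tr[of \<kappa>' x] nbr_elem[OF f Some] x by (auto simp: jump_def)
  qed
qed

section \<open>Segments that avoid the boundaries of the faces\<close>

text \<open>The part of the skeleton through which more than one face may pass. In one dimension the
  faces are points and this set is empty.\<close>

definition ridges :: "(real^'n) set" where
  "ridges = (\<Union>f\<in>faces S. emap S (owner f) ` rel_frontier (patch f))"

lemma polytope_patch: "f \<in> faces S \<Longrightarrow> polytope (patch f)"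
  using valid_face by (auto simp: valid_face_def)

lemma rel_frontier_patch: "f \<in> faces S \<Longrightarrow> rel_frontier (patch f) \<subseteq> patch f"
  using polytope_imp_closed[OF polytope_patch] by (auto simp: rel_frontier_def closure_closed)

lemma closed_ridges: "closed ridges"
  unfolding ridges_def
proof (intro closed_UN ballI finite_faces)
  fix f assume f: "f \<in> faces S"
  have "compact (rel_frontier (patch f))"
    using polytope_imp_bounded[OF polytope_patch[OF f]] by (rule compact_rel_frontier_bounded)
  then have "compact (emap S (owner f) ` rel_frontier (patch f))"
    using rel_frontier_patch[OF f] patch_subset[OF f]
    by (intro compact_continuous_image continuous_on_subset[OF emap_continuous[OF owner_elem[OF f]]]) auto
  then show "closed (emap S (owner f) ` rel_frontier (patch f))"
    by (rule compact_imp_closed)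
qed

lemma open_elem_Int_ridges:
  assumes "\<kappa> \<in> elems S"
  shows "open_elem S \<kappa> \<inter> ridges = {}"
proof -
  have "ridges \<subseteq> \<Union> (face_set S ` faces S)"
    using rel_frontier_patch by (force simp: ridges_def face_set_def)
  then show ?thesis using open_elem_Int_face[OF assms] by blast
qed

lemma face_unique:
  assumes "x \<notin> ridges" "f \<in> faces S" "f' \<in> faces S" "x \<in> face_set S f" "x \<in> face_set S f'"
  shows "f = f'"
proof (rule ccontr)
  assume "f \<noteq> f'"
  have int: "x \<in> emap S (owner f) ` rel_interior (patch f)" if "f \<in> faces S" "x \<in> face_set S f" for f
  proof -
    from that obtain y where y: "y \<in> patch f" "x = emap S (owner f) y"
      by (auto simp: face_set_def)
    moreover have "y \<notin> rel_frontier (patch f)" using assms(1) that(1) y by (auto simp: ridges_def)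
    ultimately show ?thesis
      using closure_subset[of "patch f"] by (auto simp: rel_frontier_def)
  qed
  have "disjoint_family_on (\<lambda>f. emap S (owner f) ` rel_interior (patch f)) (faces S)"
    using mesh by (simp add: valid_mesh_def)
  then show False
    using int[OF assms(2,4)] int[OF assms(3,5)] assms(2,3) \<open>f \<noteq> f'\<close>
    unfolding disjoint_family_on_def by blast
qed

text \<open>The relative boundary of a patch is the union of its finitely many facets. These have
  codimension two in space, so each of them casts a negligible shadow.\<close>

lemma negligible_ridge_shadow:
  assumes "a \<notin> ridges"
  shows "negligible {b. closed_segment a b \<inter> ridges \<noteq> {}}"
proof -
  let ?I = "SIGMA f:faces S. {R. R facet_of patch f}"
  have rf: "rel_frontier (patch f) = \<Union> {R. R facet_of patch f}" if "f \<in> faces S" for f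
    by (rule rel_frontier_of_polyhedron[OF polytope_imp_polyhedron[OF polytope_patch[OF that]]])
  have "{b. closed_segment a b \<inter> ridges \<noteq> {}} =
      (\<Union>(f, R)\<in>?I. {b. closed_segment a b \<inter> emap S (owner f) ` R \<noteq> {}})"
    using rf by (fastforce simp: ridges_def)
  moreover have "negligible (\<Union>(f, R)\<in>?I. {b. closed_segment a b \<inter> emap S (owner f) ` R \<noteq> {}})"
  proof (rule negligible_Union)
    have "finite ?I"
      using finite_faces polytope_patch finite_polytope_facets by (intro finite_SigmaI) auto
    then show "finite ((\<lambda>(f, R). {b. closed_segment a b \<inter> emap S (owner f) ` R \<noteq> {}}) ` ?I)"
      by (rule finite_imageI)
    fix T assume "T \<in> (\<lambda>(f, R). {b. closed_segment a b \<inter> emap S (owner f) ` R \<noteq> {}}) ` ?I"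
    then obtain f R where f: "f \<in> faces S" and R: "R facet_of patch f"
      and T: "T = {b. closed_segment a b \<inter> emap S (owner f) ` R \<noteq> {}}"
      by auto
    show "negligible T"
      unfolding T
    proof (rule negligible_shadow)
      show "emap S (owner f) differentiable_on R"
        using facet_of_imp_subset[OF R] patch_subset[OF f]
        by (intro differentiable_on_subset[OF emap_differentiable[OF owner_elem[OF f]]]) auto
      show "aff_dim R \<le> int CARD('n) - 2"
        using R valid_face[OF f] by (auto simp: facet_of_def valid_face_def)
      show "a \<notin> emap S (owner f) ` R"
        using assms rf[OF f] R f by (auto simp: ridges_def)
    qed
  qed
  ultimately show ?thesis by simp
qed

text \<open>Off \<open>ridges\<close> the traces of all elements at a point agree and define one
  function \<open>w\<close>, extended by 0 outside the region. The extension is made because a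
  segment between two points of a nonconvex region may leave it.\<close>

lemma continuous_coeffsI:
  assumes jump: "\<And>f x. f \<in> faces S \<Longrightarrow> x \<in> face_set S f \<Longrightarrow> jump S f (fun_of S c) x = 0"
  shows "c \<in> continuous_coeffs S"
proof -
  let ?u = "fun_of S c" and ?t = "\<lambda>\<kappa>. trace_on S \<kappa> (fun_of S c)"
  have boundary_face: "\<exists>f\<in>faces S. (owner f = \<kappa> \<or> nbr f = Some \<kappa>) \<and> x \<in> face_set S f"
    if "\<kappa> \<in> elems S" "x \<in> elem S \<kappa>" "x \<notin> open_elem S \<kappa>" for \<kappa> x
  proof -
    have "x \<in> emap S \<kappa> ` frontier (refel S \<kappa>)"
      using elem_cases[OF that(1,2)] that(3) by blast
    then show ?thesis unfolding elem_boundary[OF that(1)] by auto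
  qed
  \<comment> \<open>Both elements have a face through \<open>x\<close>, and off
    \<open>ridges\<close> it is the same face. Being distinct, they are its owner and its neighbour,
    so their traces differ by the jump, which is 0.\<close>
  have consistent: "?t \<kappa> x = ?t \<kappa>' x"
    if x: "x \<notin> ridges" and \<kappa>: "\<kappa> \<in> elems S" "x \<in> elem S \<kappa>" and \<kappa>': "\<kappa>' \<in> elems S" "x \<in> elem S \<kappa>'" for x \<kappa> \<kappa>'
  proof (cases "\<kappa> = \<kappa>'")
    case False
    have "x \<notin> open_elem S \<kappa>" "x \<notin> open_elem S \<kappa>'"
      using open_elem_Int_elem[OF \<kappa>(1) \<kappa>'(1) False] open_elem_Int_elem[OF \<kappa>'(1) \<kappa>(1)] False \<kappa> \<kappa>' by auto
    then obtain f f' where "f \<in> faces S" "owner f = \<kappa> \<or> nbr f = Some \<kappa>" "x \<in> face_set S f"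
      "f' \<in> faces S" "owner f' = \<kappa>' \<or> nbr f' = Some \<kappa>'" "x \<in> face_set S f'"
      using boundary_face \<kappa> \<kappa>' by metis
    moreover from this have "f = f'" using face_unique[OF x] by blast
    ultimately show ?thesis
      using False jump[of f x] by (auto simp: jump_def)
  qed simp
  have boundary: "?t \<kappa> x = 0"
    if x: "x \<notin> ridges" "x \<in> frontier (region S)" and \<kappa>: "\<kappa> \<in> elems S" "x \<in> elem S \<kappa>" for x \<kappa>
  proof -
    obtain f where f: "f \<in> faces S" "nbr f = None" "x \<in> face_set S f"
      using x(2) by (auto simp: frontier_region)
    then have "x \<notin> open_elem S \<kappa>" using open_elem_Int_face[OF \<kappa>(1) f(1)] by auto
    then obtain f' where f': "f' \<in> faces S" "owner f' = \<kappa> \<or> nbr f' = Some \<kappa>" "x \<in> face_set S f'"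
      using boundary_face \<kappa> by metis
    then have "f = f'" using face_unique[OF x(1)] f by blast
    then show ?thesis using f f' jump[of f x] by (auto simp: jump_def)
  qed
  \<comment> \<open>Off \<open>ridges\<close> the choice of the element does not affect the value.
    On \<open>ridges\<close> the value is arbitrary and is later replaced by that of the extension
    \<open>g\<close>.\<close>
  define w where "w x = (if \<exists>\<kappa>\<in>elems S. x \<in> elem S \<kappa> then ?t (SOME \<kappa>. \<kappa> \<in> elems S \<and> x \<in> elem S \<kappa>) x else 0)" for x
  have w_elem: "w x = ?t \<kappa> x" if "x \<notin> ridges" "\<kappa> \<in> elems S" "x \<in> elem S \<kappa>" for x \<kappa>
  proof -
    define k where "k = (SOME \<kappa>. \<kappa> \<in> elems S \<and> x \<in> elem S \<kappa>)"
    have k: "k \<in> elems S" "x \<in> elem S k"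
      using someI[of "\<lambda>\<kappa>. \<kappa> \<in> elems S \<and> x \<in> elem S \<kappa>" \<kappa>] that by (auto simp: k_def)
    then have "w x = ?t k x" by (auto simp: w_def k_def)
    then show ?thesis using consistent[OF that(1) k that(2,3)] by simp
  qed
  have w_out: "w x = 0" if "x \<notin> ridges" "x \<notin> region S" for x
  proof (cases "\<exists>\<kappa>\<in>elems S. x \<in> elem S \<kappa>")
    case True
    then obtain \<kappa> where \<kappa>: "\<kappa> \<in> elems S" "x \<in> elem S \<kappa>" by auto
    then have "x \<in> frontier (region S)"
      using that(2) open_region by (auto simp: frontier_def closure_region interior_open)
    then show ?thesis using boundary \<kappa> that w_elem by simp
  qed (auto simp: w_def)
  have "\<forall>\<kappa>\<in>elems S. \<exists>L. L-lipschitz_on (elem S \<kappa>) (?t \<kappa>)"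
    using trace_on_lipschitz(1)[OF _ piecewise_poly_fun_of] by blast
  then obtain M where M: "\<And>\<kappa>. \<kappa> \<in> elems S \<Longrightarrow> (M \<kappa>)-lipschitz_on (elem S \<kappa>) (?t \<kappa>)" by metis
  \<comment> \<open>The sum dominates the Lipschitz constant of every single element.\<close>
  define L where "L = sum M (elems S)"
  have M_nonneg: "0 \<le> M \<kappa>" if "\<kappa> \<in> elems S" for \<kappa>
    by (rule lipschitz_on_nonneg[OF M[OF that]])
  have L0: "0 \<le> L"
    unfolding L_def using M_nonneg by (rule sum_nonneg)
  have L: "M \<kappa> \<le> L" if "\<kappa> \<in> elems S" for \<kappa>
    unfolding L_def using M_nonneg member_le_sum[OF that _ finite_elems, of M] by auto
  \<comment> \<open>The closed pieces are the elements and the complement of the region. On each of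
    them \<open>w\<close> is a trace or 0 along the segment, because the segment misses
    \<open>ridges\<close>.\<close>
  have seg: "dist (w a) (w b) \<le> L * dist a b" if ab: "closed_segment a b \<inter> ridges = {}" for a b
  proof (rule lipschitz_closed_cover_segment)
    let ?\<C> = "insert (- region S) (elem S ` elems S)"
    show "finite ?\<C>" using finite_elems by simp
    show "closed C" if "C \<in> ?\<C>" for C using that open_region closed_elem by auto
    show "closed_segment a b \<subseteq> \<Union> ?\<C>"
      using closure_subset[of "region S"] by (auto simp: closure_region)
    fix C assume "C \<in> ?\<C>"
    then consider "C = - region S" | \<kappa> where "\<kappa> \<in> elems S" "C = elem S \<kappa>" by auto
    then show "L-lipschitz_on (C \<inter> closed_segment a b) w"
    proof cases
      case 1
      then have "w x = 0" if "x \<in> C \<inter> closed_segment a b" for x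
        using that ab by (intro w_out) auto
      then show ?thesis using L0 by (intro lipschitz_onI) auto
    next
      case 2
      have "L-lipschitz_on (C \<inter> closed_segment a b) (?t \<kappa>)"
        using 2 by (intro lipschitz_on_mono[OF M[OF 2(1)]] L) auto
      moreover have "w x = ?t \<kappa> x" if "x \<in> C \<inter> closed_segment a b" for x
        using that ab 2 by (intro w_elem) auto
      ultimately show ?thesis by (rule lipschitz_on_transform) auto
    qed
  qed
  have "L-lipschitz_on (- ridges) w"
  proof (rule lipschitz_onI[OF _ L0])
    fix a b assume a: "a \<in> - ridges" and b: "b \<in> - ridges"
    obtain e where e: "0 < e" "ball b e \<subseteq> - ridges"
      using closed_ridges b open_contains_ball[of "- ridges"] by (auto simp: open_Compl)
    \<comment> \<open>The segment from \<open>a\<close> to \<open>b\<close> may hit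
      \<open>ridges\<close>, but arbitrarily close to \<open>b\<close> there is an end point
      \<open>x\<close> for which the segment from \<open>a\<close> does not. The short way from
      \<open>x\<close> to \<open>b\<close> stays in a ball free of \<open>ridges\<close>. The detour
      costs at most \<open>L * r\<close> on each leg, hence \<open>2 * L * r\<close>.\<close>
    have near: "dist (w a) (w b) \<le> L * dist a b + 2 * L * r" if r: "0 < r" "r < e" for r
    proof -
      have "b \<in> closure (- {b. closed_segment a b \<inter> ridges \<noteq> {}})"
        using closure_compl_negligible[OF negligible_ridge_shadow[of a]] a by auto
      then have "\<exists>x\<in>- {b. closed_segment a b \<inter> ridges \<noteq> {}}. dist x b < r"
        using r(1) unfolding closure_approachable by blast
      then obtain x where x: "closed_segment a x \<inter> ridges = {}" "dist x b < r"
        by blast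
      have "closed_segment x b \<subseteq> ball b e"
        using x(2) r e by (intro closed_segment_subset) (auto simp: dist_commute)
      then have "dist (w x) (w b) \<le> L * dist x b" using e(2) by (intro seg) auto
      moreover have "dist (w a) (w x) \<le> L * dist a x" using x(1) by (rule seg)
      moreover have "L * dist a x \<le> L * (dist a b + r)"
        using L0 x(2) dist_triangle[of a x b] by (intro mult_left_mono) (auto simp: dist_commute)
      moreover have "L * dist x b \<le> L * r"
        using L0 x(2) by (intro mult_left_mono) auto
      ultimately show ?thesis
        using dist_triangle[of "w a" "w b" "w x"] by (simp add: algebra_simps)
    qed
    have "((\<lambda>r. L * dist a b + 2 * L * r) \<longlongrightarrow> L * dist a b + 2 * L * 0) (at_right 0)"
      by (intro tendsto_intros)
    moreover have "\<forall>\<^sub>F r in at_right 0. dist (w a) (w b) \<le> L * dist a b + 2 * L * r"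
      using eventually_at_right_real[OF e(1)] by eventually_elim (auto intro: near)
    ultimately show "dist (w a) (w b) \<le> L * dist a b"
      using tendsto_lowerbound[of _ _ "at_right (0::real)"] by fastforce
  qed
  then obtain g where g: "L-lipschitz_on (closure (- ridges)) g" "\<And>x. x \<notin> ridges \<Longrightarrow> g x = w x"
    using lipschitz_extend_closure by blast
  have elem_sub: "elem S \<kappa> \<subseteq> closure (- ridges)" if "\<kappa> \<in> elems S" for \<kappa>
    unfolding closure_open_elem[OF that, symmetric]
    using open_elem_Int_ridges[OF that] by (intro closure_mono) auto
  have gc: "continuous_on (closure (region S)) g"
    using elem_sub
    by (intro continuous_on_subset[OF lipschitz_on_continuous_on[OF g(1)]]) (auto simp: closure_region)
  have ug: "?u x = g x" if "\<kappa> \<in> elems S" "x \<in> open_elem S \<kappa>" for x \<kappa>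
  proof -
    have "x \<notin> ridges" using open_elem_Int_ridges that by auto
    then show ?thesis
      using g(2) w_elem[OF _ that(1)] that open_elem_subset[of \<kappa>]
        trace_on_lipschitz(2)[OF that(1) piecewise_poly_fun_of that(2)] by auto
  qed
  \<comment> \<open>Since \<open>x\<close> may lie on \<open>ridges\<close>, \<open>g x\<close>
    cannot be read off from \<open>w\<close>. Continuity of \<open>g\<close> up to the boundary
    identifies it with the trace from the owner, which is the jump on a boundary face.\<close>
  have gf: "g x = 0" if "x \<in> frontier (region S)" for x
  proof -
    from that obtain f where f: "f \<in> faces S" "nbr f = None" "x \<in> face_set S f"
      by (auto simp: frontier_region)
    have x: "x \<in> elem S (owner f)" using face_subset_owner[OF f(1)] f(3) by auto
    have "continuous_on (elem S (owner f)) g"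
      using owner_elem[OF f(1)] by (intro continuous_on_subset[OF gc]) (auto simp: closure_region)
    then have "?t (owner f) x = g x"
      by (rule trace_on_continuous[OF owner_elem[OF f(1)] x _ ug[OF owner_elem[OF f(1)]]])
    then show ?thesis using jump[OF f(1,3)] f(2) by (simp add: jump_def)
  qed
  \<comment> \<open>Outside the open elements nothing is known about \<open>fun_of S c\<close>. What
    remains of the region lies in the element boundaries, differentiable images of frontiers of
    convex sets and hence null sets.\<close>
  have gu: "AE x in lebesgue_on (region S). ?u x = g x"
    unfolding AE_region
  proof (rule AE_I')
    let ?N = "\<Union>\<kappa>\<in>elems S. emap S \<kappa> ` frontier (refel S \<kappa>)"
    have "negligible (emap S \<kappa> ` frontier (refel S \<kappa>))" if "\<kappa> \<in> elems S" for \<kappa>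
      using frontier_refel_subset[OF that]
      by (intro negligible_differentiable_image_negligible negligible_convex_frontier convex_refel that
          differentiable_on_subset[OF emap_differentiable[OF that]]) auto
    then have "negligible ?N"
      using finite_elems by (intro negligible_Union) auto
    then show "?N \<in> null_sets lebesgue" by (simp add: negligible_iff_null_sets)
    show "{x \<in> space lebesgue. \<not> (x \<in> region S \<longrightarrow> ?u x = g x)} \<subseteq> ?N"
    proof
      fix x assume "x \<in> {x \<in> space lebesgue. \<not> (x \<in> region S \<longrightarrow> ?u x = g x)}"
      then have x: "x \<in> region S" "?u x \<noteq> g x" by auto
      then obtain \<kappa> where \<kappa>: "\<kappa> \<in> elems S" "x \<in> elem S \<kappa>"
        using closure_subset[of "region S"] by (auto simp: closure_region)
      then have "x \<in> emap S \<kappa> ` frontier (refel S \<kappa>)"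
        using ug[OF \<kappa>(1), of x] x(2) by (cases rule: elem_cases[OF \<kappa>]) simp_all
      then show "x \<in> ?N" using \<kappa>(1) by (rule UN_I[rotated])
    qed
  qed
  show ?thesis
    unfolding continuous_coeffs_def
  proof (rule CollectI, rule exI[of _ g], intro conjI ballI)
    show "continuous_on (closure (region S)) g" by (rule gc)
    show "g x = 0" if "x \<in> frontier (region S)" for x by (rule gf[OF that])
    show "AE x in lebesgue_on (region S). ?u x = g x" by (rule gu)
  qed
qed

section \<open>The preconditioned operators\<close>

lemma invertible_sweep:
  "\<forall>\<^sub>F \<epsilon> in at_right 0. invertible (sweep S \<epsilon>) \<and> invertible (sweep_le S \<epsilon>)"
  unfolding sweep_def sweep_le_def by (intro eventually_conj mat1_plus_small(1))

text \<open>As \<open>sweep S \<epsilon>\<close> is invertible, its defining equation can be solved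
  for \<open>K\<close> in exactly one way, so the definite description denotes this matrix.\<close>

lemma M3_inv_eq:
  assumes inv: "invertible (sweep S \<epsilon>)"
    and X: "X = mat 1 - matrix_inv (sweep_le S \<epsilon>) ** sweep S \<epsilon>"
  shows "M3_inv S \<epsilon> = matrix_inv (sweep S \<epsilon>) - X ** X ** X ** matrix_inv (sweep S \<epsilon>)"
  unfolding M3_inv_def Let_def X[symmetric]
proof (rule the_equality)
  let ?A = "sweep S \<epsilon>" and ?Y = "X ** X ** X"
  show "mat 1 - (matrix_inv ?A - ?Y ** matrix_inv ?A) ** ?A = ?Y"
    by (simp add: matrix_sub_rdistrib matrix_mul_assoc[symmetric] matrix_inv_left[OF inv])
  fix K assume K: "mat 1 - K ** ?A = ?Y"
  have "K ** ?A ** matrix_inv ?A = (mat 1 - ?Y) ** matrix_inv ?A"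
    unfolding K[symmetric] by simp
  then show "K = matrix_inv ?A - ?Y ** matrix_inv ?A"
    by (simp add: matrix_sub_rdistrib matrix_mul_assoc[symmetric] matrix_inv_right[OF inv])
qed

lemma matrix_bigo_sweep: "matrix_bigo 0 (sweep S)"
proof -
  have "matrix_bigo 0 (\<lambda>\<epsilon>. \<epsilon> powi 1 *\<^sub>R Hmat S)"
    using matrix_bigo_powi_scaleR[OF matrix_bigo_const[of "Hmat S"], of 1]
    by (rule matrix_bigo_mono) simp
  then have "matrix_bigo 0 (\<lambda>\<epsilon>. mat 1 + \<epsilon> powi 1 *\<^sub>R Hmat S)"
    by (intro matrix_bigo_add matrix_bigo_const)
  then show ?thesis by (simp add: sweep_def[abs_def])
qed

lemma matrix_bigo_neg_Bmat: "matrix_bigo 0 (\<lambda>\<epsilon>. - Bmat S \<epsilon>)"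
proof -
  let ?N = "block_diag (\<lambda>d. matrix_inv (Mt S) ** Ma S) ** P0 S"
  have "matrix_bigo 0 (\<lambda>\<epsilon>. \<epsilon> powi 2 *\<^sub>R ?N)"
    using matrix_bigo_powi_scaleR[OF matrix_bigo_const[of ?N], of 2]
    by (rule matrix_bigo_mono) simp
  then have "matrix_bigo 0 (\<lambda>\<epsilon>. - P0 S + \<epsilon> powi 2 *\<^sub>R ?N)"
    by (intro matrix_bigo_add matrix_bigo_const)
  moreover have "- Bmat S \<epsilon> = - P0 S + \<epsilon> powi 2 *\<^sub>R ?N" for \<epsilon>
    by (simp add: Bmat_def matrix_sub_rdistrib scalar_matrix_assoc[symmetric])
  ultimately show ?thesis by simp
qed

lemma T_tilde_minus_T_op: "matrix_bigo 3 (\<lambda>\<epsilon>. T_tilde S \<epsilon> - T_op S \<epsilon>)"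
proof -
  \<comment> \<open>The error propagator of one iteration. In this form the factor \<epsilon>
    contributed by the omitted part \<open>H_gt S\<close> is explicit, so its order is 1.\<close>
  define X where "X \<epsilon> = matrix_inv (sweep_le S \<epsilon>) ** (\<epsilon> powi 1 *\<^sub>R (- H_gt S))" for \<epsilon>
  have "matrix_bigo (0 + (1 + 0)) X"
    unfolding X_def sweep_le_def
    by (intro matrix_bigo_mult matrix_bigo_powi_scaleR matrix_bigo_const mat1_plus_small(2))
  then have X: "matrix_bigo 1 X" by simp
  have "matrix_bigo 0 (\<lambda>\<epsilon>. sweep S \<epsilon> + - Bmat S \<epsilon>)"
    by (intro matrix_bigo_add matrix_bigo_sweep matrix_bigo_neg_Bmat)
  moreover have "matrix_bigo 0 (\<lambda>\<epsilon>. matrix_inv (sweep S \<epsilon>))"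
    unfolding sweep_def by (rule mat1_plus_small(2))
  ultimately have "matrix_bigo (1 + 1 + 1 + 0 + 0)
      (\<lambda>\<epsilon>. X \<epsilon> ** X \<epsilon> ** X \<epsilon> ** matrix_inv (sweep S \<epsilon>) ** (sweep S \<epsilon> + - Bmat S \<epsilon>))"
    by (intro matrix_bigo_mult X)
  then have "matrix_bigo 3
      (\<lambda>\<epsilon>. X \<epsilon> ** X \<epsilon> ** X \<epsilon> ** matrix_inv (sweep S \<epsilon>) ** (sweep S \<epsilon> + - Bmat S \<epsilon>))"
    by simp
  then show ?thesis
  proof (rule matrix_bigo_cong)
    show "\<forall>\<^sub>F \<epsilon> in at_right 0. T_tilde S \<epsilon> - T_op S \<epsilon> =
        X \<epsilon> ** X \<epsilon> ** X \<epsilon> ** matrix_inv (sweep S \<epsilon>) ** (sweep S \<epsilon> + - Bmat S \<epsilon>)"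
      using invertible_sweep
    proof eventually_elim
      case (elim \<epsilon>)
      have "sweep S \<epsilon> = sweep_le S \<epsilon> - \<epsilon> powi 1 *\<^sub>R (- H_gt S)"
        by (simp add: sweep_def sweep_le_def Hmat_split scaleR_add_right)
      then have "mat 1 - matrix_inv (sweep_le S \<epsilon>) ** sweep S \<epsilon> = X \<epsilon>"
        using elim by (simp only: matrix_sub_ldistrib matrix_inv_left X_def) simp
      then have M3: "M3_inv S \<epsilon> = matrix_inv (sweep S \<epsilon>) - X \<epsilon> ** X \<epsilon> ** X \<epsilon> ** matrix_inv (sweep S \<epsilon>)"
        using elim by (intro M3_inv_eq) auto
      show ?case
        by (simp add: T_tilde_def T_op_def M3 matrix_sub_rdistrib)
    qed
  qed
qed

section \<open>Orders of the DSA preconditioners\<close>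

lemma DSA_error:
  assumes "matrix_bigo (- 2) E"
  shows "(\<lambda>\<epsilon>. opnorm (E \<epsilon> ** P0 S ** (mat 1 - T_op S \<epsilon>) ** P0 S
      - E \<epsilon> ** P0 S ** (mat 1 - T_tilde S \<epsilon>) ** P0 S)) \<in> O[at_right 0](\<lambda>\<epsilon>. \<epsilon>)"
proof -
  have "matrix_bigo (- 2 + 0 + 3 + 0) (\<lambda>\<epsilon>. E \<epsilon> ** P0 S ** (T_tilde S \<epsilon> - T_op S \<epsilon>) ** P0 S)"
    by (intro matrix_bigo_mult assms matrix_bigo_const T_tilde_minus_T_op)
  then have "matrix_bigo (int 1) (\<lambda>\<epsilon>. E \<epsilon> ** P0 S ** (T_tilde S \<epsilon> - T_op S \<epsilon>) ** P0 S)"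
    by simp
  from matrix_bigo_imp_bigo[OF this] show ?thesis
    by (simp add: matrix_sub_ldistrib matrix_sub_rdistrib)
qed

text \<open>Both compressed solves enter as fixed matrices; the two nested factors 1 / \<epsilon>
  carry all of the growth.\<close>

lemma matrix_bigo_DSA_two_step: "matrix_bigo (- 2) (DSA_two_step S P)"
proof -
  define EP where "EP = compression_solve P (D0 S)"
  define C where "C = (mat 1 - EP ** D0 S) ** compression_solve (mat 1 - P) (F0 S) ** (mat 1 - D0 S ** EP)"
  have "matrix_bigo (-1) (\<lambda>\<epsilon>. \<epsilon> powi (-1) *\<^sub>R EP)"
    using matrix_bigo_powi_scaleR[OF matrix_bigo_const[of EP], of "-1"] by simp
  then have "matrix_bigo (-1) (\<lambda>\<epsilon>. \<epsilon> powi (-1) *\<^sub>R EP + C)"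
    by (intro matrix_bigo_add matrix_bigo_mono[OF matrix_bigo_const]) auto
  then have "matrix_bigo (-1 + -1 + 0) (\<lambda>\<epsilon>. (\<epsilon> powi (-1) *\<^sub>R (\<epsilon> powi (-1) *\<^sub>R EP + C)) ** Mt S)"
    by (intro matrix_bigo_mult matrix_bigo_powi_scaleR matrix_bigo_const)
  then have "matrix_bigo (-2) (\<lambda>\<epsilon>. block_diag (\<lambda>d::'d. (\<epsilon> powi (-1) *\<^sub>R (\<epsilon> powi (-1) *\<^sub>R EP + C)) ** Mt S))"
    by (intro matrix_bigo_block_diag) simp
  moreover have "DSA_two_step S P \<epsilon> =
      block_diag (\<lambda>d::'d. (\<epsilon> powi (-1) *\<^sub>R (\<epsilon> powi (-1) *\<^sub>R EP + C)) ** Mt S)" for \<epsilon>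
    by (simp add: DSA_two_step_def EP_def C_def Let_def divide_inverse power_int_minus)
  ultimately show ?thesis by (simp add: matrix_bigo_cong)
qed

text \<open>Absence of jumps is the link: it characterizes the kernel of \<open>F0 S\<close> through
  the quadratic form, and the continuous functions with zero boundary values through the segment
  argument.\<close>

lemma range_P_eq_kernel_F0:
  assumes "continuous_projection S P" "alpha_bounded_below S"
  shows "range ((*v) P) = {c. F0 S *v c = 0}"
proof -
  have "c \<in> continuous_coeffs S \<longleftrightarrow> F0 S *v c = 0" for c
    using F0_kernelI[of c] F0_kernelD[OF assms(2), of c] jump_continuous_coeffs[of c] continuous_coeffsI[of c]
    by blast
  then show ?thesis using assms(1) by (auto simp: continuous_projection_def)
qed

lemma D_eps_bounded_below:
  assumes "continuous_projection S P" "compression_invertible P (D0 S)" "alpha_bounded_below S"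
  shows "\<exists>c>0. \<forall>\<^sub>F \<epsilon> in at_right 0. \<forall>x. c * norm x \<le> norm (D_eps S \<epsilon> *v x)"
  unfolding D_eps_def
  using assms(1,2) transpose_F0 range_P_eq_kernel_F0[OF assms(1,3)]
  by (intro singular_perturbation_bounded_below) (auto simp: continuous_projection_def)

text \<open>The lower bound for \<open>D_eps\<close> is uniform in \<epsilon>, so the inverse grows
  only through the prefactor \<open>\<epsilon>\<^sup>2\<close>.\<close>

lemma matrix_bigo_DSA_full:
  assumes "continuous_projection S P" "compression_invertible P (D0 S)" "alpha_bounded_below S"
  shows "matrix_bigo (- 2) (DSA_full S)"
proof -
  obtain c where c: "0 < c" "\<forall>\<^sub>F \<epsilon> in at_right 0. \<forall>x. c * norm x \<le> norm (D_eps S \<epsilon> *v x)"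
    using D_eps_bounded_below[OF assms] by blast
  have "\<forall>\<^sub>F \<epsilon> in at_right 0. opnorm (matrix_inv (\<epsilon>\<^sup>2 *\<^sub>R D_eps S \<epsilon>)) \<le> (1 / c) * \<epsilon> powi (- 2)"
    using c(2) eventually_at_right_pos
  proof eventually_elim
    case (elim \<epsilon>)
    have "(\<epsilon>\<^sup>2 * c) * norm x \<le> norm ((\<epsilon>\<^sup>2 *\<^sub>R D_eps S \<epsilon>) *v x)" for x
      using elim by (simp add: scaleR_matrix_vector_assoc[symmetric] mult.assoc mult_left_mono)
    then have "opnorm (matrix_inv (\<epsilon>\<^sup>2 *\<^sub>R D_eps S \<epsilon>)) \<le> 1 / (\<epsilon>\<^sup>2 * c)"
      using elim(2) c(1) by (intro bounded_below_invertible(2)) auto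
    then show ?case by (simp add: power_int_minus field_simps)
  qed
  then have "matrix_bigo (- 2) (\<lambda>\<epsilon>. matrix_inv (\<epsilon>\<^sup>2 *\<^sub>R D_eps S \<epsilon>))"
    unfolding matrix_bigo_def using c(1) by (intro exI[of _ "1 / c"]) simp
  then have "matrix_bigo (- 2 + 0) (\<lambda>\<epsilon>. matrix_inv (\<epsilon>\<^sup>2 *\<^sub>R D_eps S \<epsilon>) ** Mt S)"
    by (intro matrix_bigo_mult matrix_bigo_const)
  then show ?thesis
    unfolding DSA_full_def by (intro matrix_bigo_block_diag) simp
qed

text \<open>\<open>matrix_inv\<close> is a total function; this shows that in
  \<open>DSA_full\<close> it denotes a true inverse for small \<epsilon>.\<close>

lemma invertible_D_eps:
  assumes "continuous_projection S P" "compression_invertible P (D0 S)" "alpha_bounded_below S"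
  shows "\<forall>\<^sub>F \<epsilon> in at_right 0. invertible (D_eps S \<epsilon>)"
proof -
  obtain c where c: "0 < c" "\<forall>\<^sub>F \<epsilon> in at_right 0. \<forall>x. c * norm x \<le> norm (D_eps S \<epsilon> *v x)"
    using D_eps_bounded_below[OF assms] by blast
  show ?thesis
    using c(2) by (rule eventually_mono) (use bounded_below_invertible(1)[OF c(1)] in blast)
qed

text \<open>Admissible values form a subset of the positive ones, so eventual statements and bounds
  along \<open>at_right 0\<close> carry over.\<close>

lemma eps_to_0_le: "eps_to_0 S \<le> at_right 0"
  unfolding eps_to_0_def by (rule at_le) auto

end

theorem theorem3p3:
  fixes S :: "('e, 'n::finite, 'k::finite, 'd::finite) dg_setup"
  assumes "valid_setup S"
  shows "(\<forall>\<^sub>F \<epsilon> in eps_to_0 S. invertible (sweep S \<epsilon>) \<and> invertible (sweep_le S \<epsilon>)) \<and>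
    (\<lambda>\<epsilon>. opnorm (T_tilde S \<epsilon> - T_op S \<epsilon>)) \<in> O[eps_to_0 S](\<lambda>\<epsilon>. \<epsilon> ^ 3) \<and>
    (\<forall>P. continuous_projection S P \<and> compression_invertible P (D0 S) \<longrightarrow>
      (alpha_bounded_below S \<longrightarrow>
        (\<forall>\<^sub>F \<epsilon> in eps_to_0 S. invertible (D_eps S \<epsilon>)) \<and>
        (\<lambda>\<epsilon>. opnorm (DSA_full S \<epsilon> ** P0 S ** (mat 1 - T_op S \<epsilon>) ** P0 S
                    - DSA_full S \<epsilon> ** P0 S ** (mat 1 - T_tilde S \<epsilon>) ** P0 S))
          \<in> O[eps_to_0 S](\<lambda>\<epsilon>. \<epsilon>)) \<and>
      (compression_invertible (mat 1 - P) (F0 S) \<longrightarrow>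
        (\<lambda>\<epsilon>. opnorm (DSA_two_step S P \<epsilon> ** P0 S ** (mat 1 - T_op S \<epsilon>) ** P0 S
                    - DSA_two_step S P \<epsilon> ** P0 S ** (mat 1 - T_tilde S \<epsilon>) ** P0 S))
          \<in> O[eps_to_0 S](\<lambda>\<epsilon>. \<epsilon>)))"
proof -
  interpret dg S by (rule dg.intro) (rule assms)
  have ev: "\<forall>\<^sub>F \<epsilon> in eps_to_0 S. Q \<epsilon>" if "\<forall>\<^sub>F \<epsilon> in at_right 0. Q \<epsilon>" for Q
    using eps_to_0_le that by (rule filter_leD)
  have bo: "h \<in> O[eps_to_0 S](k)" if "h \<in> O[at_right 0](k)" for h k :: "real \<Rightarrow> real"
    using landau_o.big.filter_mono[OF eps_to_0_le] that by blast
  show ?thesis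
  proof (intro conjI allI impI; (elim conjE)?)
    show "\<forall>\<^sub>F \<epsilon> in eps_to_0 S. invertible (sweep S \<epsilon>) \<and> invertible (sweep_le S \<epsilon>)"
      by (rule ev[OF invertible_sweep])
    show "(\<lambda>\<epsilon>. opnorm (T_tilde S \<epsilon> - T_op S \<epsilon>)) \<in> O[eps_to_0 S](\<lambda>\<epsilon>. \<epsilon> ^ 3)"
      using T_tilde_minus_T_op by (intro bo matrix_bigo_imp_bigo) simp
  next
    fix P assume P: "continuous_projection S P" "compression_invertible P (D0 S)" "alpha_bounded_below S"
    show "\<forall>\<^sub>F \<epsilon> in eps_to_0 S. invertible (D_eps S \<epsilon>)"
      by (rule ev[OF invertible_D_eps[OF P]])
    show "(\<lambda>\<epsilon>. opnorm (DSA_full S \<epsilon> ** P0 S ** (mat 1 - T_op S \<epsilon>) ** P0 S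
                    - DSA_full S \<epsilon> ** P0 S ** (mat 1 - T_tilde S \<epsilon>) ** P0 S))
          \<in> O[eps_to_0 S](\<lambda>\<epsilon>. \<epsilon>)"
      by (rule bo[OF DSA_error[OF matrix_bigo_DSA_full[OF P]]])
  next
    fix P
    show "(\<lambda>\<epsilon>. opnorm (DSA_two_step S P \<epsilon> ** P0 S ** (mat 1 - T_op S \<epsilon>) ** P0 S
                    - DSA_two_step S P \<epsilon> ** P0 S ** (mat 1 - T_tilde S \<epsilon>) ** P0 S))
          \<in> O[eps_to_0 S](\<lambda>\<epsilon>. \<epsilon>)"
      by (rule bo[OF DSA_error[OF matrix_bigo_DSA_two_step]])
  qed
qed

end
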